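(* Let $\gamma\in\mathbb{R}$ and $1\le p<\infty$. There is a constant $C>0$ such that for every radially symmetric $u\in\widetilde W^{1,1}_{loc}$ satisfying either ($\gamma>1-N$ and $u\in\widetilde W^{1,1}_{loc,-}$) or ($\gamma<1-N$ and $u\in\widetilde W^{1,1}_{loc,+}$), one has $\||x|^{N-1+\gamma}u\|_\infty\le C\,\||x|^{\gamma+\frac{N}{p'}}\partial_\rho u\|_p$ (both sides possibly infinite; finiteness of the right-hand side implies finiteness of the left-hand side). Furthermore, if $p=1$, this inequality remains true when $\gamma=1-N$.
   Context: $N\ge1$, $\mathbb{R}^N_*:=\mathbb{R}^N\setminus\{0\}$, $\|\cdot\|_s$ the $L^s(\mathbb{R}^N)$ (quasi-)norm, $p'$ the Hölder conjugate of $p$ ($p'=\infty$ if $p=1$, so $N/p'=0$). For a distribution $u$ on $\mathbb{R}^N_*$, $\partial_\rho u:=\nabla u\cdot\frac{x}{|x|}$. $\widetilde W^{1,1}_{loc}:=\{u\in L^1_{loc}(\mathbb{R}^N_* ):\partial_\rho u\in L^1_{loc}(\mathbb{R}^N_* )\}$. With $\omega_N$ the volume of the unit ball, $f_u(t):=(N\omega_N)^{-1}\int_{\mathbb{S}^{N-1}}u(t\sigma)d\sigma$; for $u\in\widetilde W^{1,1}_{loc}$, $f_{|u|}$ is (has a representative that is) continuous on $(0,\infty)$. $\widetilde W^{1,1}_{loc,-}:=\{u\in\widetilde W^{1,1}_{loc}:\liminf_{t\to\infty}f_{|u|}(t)=0\}$ and $\widetilde W^{1,1}_{loc,+}:=\{u\in\widetilde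 W^{1,1}_{loc}:\liminf_{t\to0^+}f_{|u|}(t)=0\}$. $u$ is radially symmetric if $u(x)$ depends only on $|x|$. *)

theory Defs
  imports "HOL-Analysis.Analysis" "HOL-Probability.Essential_Supremum"
begin

fun Ck :: "nat \<Rightarrow> ('a::euclidean_space \<Rightarrow> real) \<Rightarrow> bool" where
  "Ck 0 \<phi> = continuous_on UNIV \<phi>"
| "Ck (Suc k) \<phi> = ((\<forall>x. \<phi> differentiable (at x)) \<and>
      (\<forall>i\<in>Basis. Ck k (\<lambda>x. frechet_derivative \<phi> (at x) i)))"

definition smooth :: "('a::euclidean_space \<Rightarrow> real) \<Rightarrow> bool" where
  "smooth \<phi> = (\<forall>k. Ck k \<phi>)"

definition test_fun_punct :: "('a::euclidean_space \<Rightarrow> real) \<Rightarrow> bool" where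
  "test_fun_punct \<phi> = (smooth \<phi> \<and> compact (closure {x. \<phi> x \<noteq> 0}) \<and>
      (0::'a) \<notin> closure {x. \<phi> x \<noteq> 0})"

definition L1_loc_punct :: "('a::euclidean_space \<Rightarrow> real) \<Rightarrow> bool" where
  "L1_loc_punct u = (\<forall>K. compact K \<and> (0::'a) \<notin> K \<longrightarrow> set_integrable lebesgue K u)"

text \<open>g is the distributional radial derivative of u on R^N minus the origin:
  <\<nabla>u . x/|x|, \<phi>> = - \<integral> u div(\<phi> x/|x|), div(\<phi> x/|x|) = \<nabla>\<phi> . x/|x| + (N-1) \<phi>/|x|.\<close>
definition radial_deriv :: "('a::euclidean_space \<Rightarrow> real) \<Rightarrow> ('a \<Rightarrow> real) \<Rightarrow> bool" where
  "radial_deriv u g = (\<forall>\<phi>. test_fun_punct \<phi> \<longrightarrow>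
      (\<integral>x. u x * (frechet_derivative \<phi> (at x) (x /\<^sub>R norm x)
                 + (real DIM('a) - 1) * \<phi> x / norm x) \<partial>lebesgue)
      = - (\<integral>x. g x * \<phi> x \<partial>lebesgue))"

definition W11_loc :: "('a::euclidean_space \<Rightarrow> real) \<Rightarrow> ('a \<Rightarrow> real) \<Rightarrow> bool" where
  "W11_loc u g = (L1_loc_punct u \<and> L1_loc_punct g \<and> radial_deriv u g)"

text \<open>Surface integral over the unit sphere, via the cone-measure definition
  \<integral>_{S} h d\<sigma> = N \<integral>_{B_1} h(x/|x|) dx  (so that \<sigma>(S) = N \<omega>_N).\<close>
definition sphere_integral :: "('a::euclidean_space \<Rightarrow> real) \<Rightarrow> real" where
  "sphere_integral h = real DIM('a) * (\<integral>x\<in>ball 0 1. h (x /\<^sub>R norm x) \<partial>lebesgue)"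

definition omega :: "'a::euclidean_space itself \<Rightarrow> real" where
  "omega _ = measure lebesgue (ball (0::'a) 1)"

definition sph_mean :: "('a::euclidean_space \<Rightarrow> real) \<Rightarrow> real \<Rightarrow> real" where
  "sph_mean u t = sphere_integral (\<lambda>\<sigma>. u (t *\<^sub>R \<sigma>)) / (real DIM('a) * omega TYPE('a))"

definition W11_minus :: "('a::euclidean_space \<Rightarrow> real) \<Rightarrow> bool" where
  "W11_minus u = (\<exists>F. continuous_on {0<..} F \<and>
      (AE t in lborel. t > 0 \<longrightarrow> F t = sph_mean (\<lambda>x. \<bar>u x\<bar>) t) \<and>
      Liminf at_top (\<lambda>t. ereal (F t)) = 0)"

definition W11_plus :: "('a::euclidean_space \<Rightarrow> real) \<Rightarrow> bool" where
  "W11_plus u = (\<exists>F. continuous_on {0<..} F \<and>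
      (AE t in lborel. t > 0 \<longrightarrow> F t = sph_mean (\<lambda>x. \<bar>u x\<bar>) t) \<and>
      Liminf (at_right 0) (\<lambda>t. ereal (F t)) = 0)"

definition radially_symmetric :: "('a::real_normed_vector \<Rightarrow> real) \<Rightarrow> bool" where
  "radially_symmetric u = (\<forall>x y. norm x = norm y \<longrightarrow> u x = u y)"

definition Lp_norm :: "real \<Rightarrow> ('a::euclidean_space \<Rightarrow> real) \<Rightarrow> ereal" where
  "Lp_norm p f = (let I = (\<integral>\<^sup>+x. ennreal (\<bar>f x\<bar> powr p) \<partial>lebesgue) in
      if I = \<infinity> then \<infinity> else ereal (enn2real I powr (1 / p)))"

definition Linf_norm :: "('a::euclidean_space \<Rightarrow> real) \<Rightarrow> ereal" where
  "Linf_norm f = esssup lebesgue (\<lambda>x. ereal \<bar>f x\<bar>)"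

text \<open>N / p' with p' the Hoelder conjugate (N/p' = 0 for p = 1).\<close>
definition N_over_conj :: "real \<Rightarrow> real \<Rightarrow> real" where
  "N_over_conj N p = N * (1 - 1 / p)"

end

theory Submission
  imports Defs
begin

text \<open>
  Write \<open>u x = V (x \<bullet> x)\<close>. Testing the weak formulation with radial functions shows that
  for almost all \<open>a < b\<close> the difference \<open>\<bar>V a - V b\<bar>\<close> is at most \<open>1 / (N \<omega>)\<close> times the
  integral of \<open>norm x powr (1 - N) * \<bar>g x\<bar>\<close> over
  \<open>{x. a \<le> x \<bullet> x \<le> b}\<close>. The vanishing lower limit of the spherical means lets one endpoint run to
  infinity (or to the origin) along points where \<open>V\<close> is small, so \<open>\<bar>V a\<bar>\<close> is bounded by the
  integral over the exterior (or interior) of a ball. Hoelder's inequality against a pure power of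
  \<open>norm x\<close> then yields the weighted bound; the power is integrable to the conjugate exponent on that
  region exactly because of the sign of \<open>\<gamma> + N - 1\<close>, and for \<open>p = 1\<close> only its supremum is needed,
  which also allows \<open>\<gamma> = 1 - N\<close>.
\<close>

subsection \<open>Smooth functions\<close>

text \<open>Both sides of the inequality scale alike under dilations. Put
  \<open>\<kappa> = N - 1 + \<gamma>\<close> and let \<open>q\<close> be the conjugate exponent. For
  \<open>p > 1\<close> the \<open>q\<close>-th power of the leftover weight is |x|^(-\<kappa> q -
  N), and its integral outside (or inside) radius r is N \<omega> r^(-\<kappa> q) / (|\<kappa>| q).
  The \<open>q\<close>-th root is a constant times r^(-\<kappa>), which the weight on the left
  absorbs. Division by N \<omega> gives the final constant; for \<open>p = 1\<close> it is 1 / (N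
  \<omega>).

  The obstacle is regularity. The weak formulation admits only smooth test functions, and
  \<open>u\<close> matters only up to null sets, so values of \<open>V\<close> cannot be compared
  directly: smooth bumps compare averages over short intervals, and Lebesgue differentiation
  recovers the values off a null set. The lower limit likewise concerns a continuous function that
  agrees with |V| only almost everywhere; a usable small value is found because a nonempty open set
  is never null. Integrals over tails may be infinite until Hoelder's inequality is applied, so they
  are kept in \<open>ennreal\<close>.\<close>

lemma Ck_coinduct:
  fixes S :: "('a::euclidean_space \<Rightarrow> real) set"
  assumes diff: "\<And>f x. f \<in> S \<Longrightarrow> f differentiable (at x)"
    and deriv: "\<And>f i. f \<in> S \<Longrightarrow> i \<in> Basis \<Longrightarrow> (\<lambda>x. frechet_derivative f (at x) i) \<in> S"
    and "f \<in> S"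
  shows "Ck k f"
  using \<open>f \<in> S\<close>
proof (induction k arbitrary: f)
  case 0
  then show ?case
    by (auto simp: continuous_on_eq_continuous_at intro: differentiable_imp_continuous_within diff)
next
  case (Suc k)
  then show ?case by (simp add: diff deriv)
qed

lemma Ck_Suc_imp_Ck: "Ck (Suc k) \<phi> \<Longrightarrow> Ck k \<phi>"
proof (induction k arbitrary: \<phi>)
  case 0
  then show ?case
    by (auto simp: continuous_on_eq_continuous_at intro: differentiable_imp_continuous_within)
next
  case (Suc k)
  from Suc.prems have "\<And>i. i \<in> Basis \<Longrightarrow> Ck k (\<lambda>x. frechet_derivative \<phi> (at x) i)"
    unfolding Ck.simps(2)[of "Suc k"] using Suc.IH by blast
  with Suc.prems show ?case by simp
qed

lemma Ck_const: "Ck k (\<lambda>x. c)"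
  by (rule Ck_coinduct[where S = "range (\<lambda>c x. c)"]) auto

lemma Ck_add:
  assumes "Ck k f" "Ck k g"
  shows "Ck k (\<lambda>x. f x + g x)"
  using assms
proof (induction k arbitrary: f g)
  case (Suc k)
  have "frechet_derivative (\<lambda>x. f x + g x) (at x)
      = (\<lambda>v. frechet_derivative f (at x) v + frechet_derivative g (at x) v)" for x
    using Suc.prems
    by (intro frechet_derivative_at[symmetric] has_derivative_add)
      (simp_all add: frechet_derivative_works)
  with Suc show ?case by simp
qed (auto intro: continuous_intros)

lemma Ck_mult:
  assumes "Ck k f" "Ck k g"
  shows "Ck k (\<lambda>x. f x * g x)"
  using assms
proof (induction k arbitrary: f g)
  case (Suc k)
  have "frechet_derivative (\<lambda>x. f x * g x) (at x)
      = (\<lambda>v. f x * frechet_derivative g (at x) v + frechet_derivative f (at x) v * g x)" for x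
    using Suc.prems
    by (intro frechet_derivative_at[symmetric] has_derivative_mult)
      (simp_all add: frechet_derivative_works)
  with Suc Suc.prems[THEN Ck_Suc_imp_Ck] show ?case by (simp add: Ck_add)
qed (auto intro: continuous_intros)

lemma Ck_inner_right: "Ck k (\<lambda>x. x \<bullet> v)"
proof -
  have "frechet_derivative (\<lambda>x. x \<bullet> v) (at x) = (\<lambda>x. x \<bullet> v)" for x
    by (rule frechet_derivative_at[symmetric]) (auto intro!: derivative_eq_intros)
  then show ?thesis
    by (cases k) (auto simp: Ck_const intro: continuous_intros)
qed

lemma Ck_ident: "Ck k (\<lambda>x::real. x)"
  using Ck_inner_right[of k "1::real"] by simp

lemma Ck_sum: "(\<And>i. i \<in> I \<Longrightarrow> Ck k (f i)) \<Longrightarrow> Ck k (\<lambda>x. \<Sum>i\<in>I. f i x)"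
  by (induction I rule: infinite_finite_induct) (auto simp: Ck_const intro: Ck_add)

lemma Ck_inner_self: "Ck k (\<lambda>x::'a::euclidean_space. x \<bullet> x)"
  by (subst euclidean_inner) (intro Ck_sum Ck_mult Ck_inner_right)

lemma frechet_derivative_real:
  assumes "(f has_real_derivative D) (at x)"
  shows "frechet_derivative f (at x) v = D * v"
  using frechet_derivative_at[OF assms[unfolded has_field_derivative_def]] by simp

lemma Ck_Suc_real_iff:
  fixes f :: "real \<Rightarrow> real"
  assumes "\<And>x. (f has_real_derivative f' x) (at x)"
  shows "Ck (Suc k) f \<longleftrightarrow> Ck k f'"
  using assms by (auto simp: frechet_derivative_real[OF assms] real_differentiable_def)

lemma Ck_compose:
  fixes h :: "real \<Rightarrow> real" and f :: "'a::euclidean_space \<Rightarrow> real"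
  assumes "Ck k h" "Ck k f"
  shows "Ck k (\<lambda>x. h (f x))"
  using assms
proof (induction k arbitrary: h f)
  case 0
  then show ?case by (auto intro: continuous_on_compose2)
next
  case (Suc k)
  from Suc.prems obtain h' where h': "\<And>x. (h has_real_derivative h' x) (at x)"
    by (auto simp: real_differentiable_def) metis
  have f': "(f has_derivative frechet_derivative f (at x)) (at x)" for x
    using Suc.prems by (simp add: frechet_derivative_works)
  have D: "((\<lambda>x. h (f x)) has_derivative (\<lambda>v. frechet_derivative f (at x) v * h' (f x))) (at x)" for x
    using has_derivative_compose[OF f' h'[unfolded has_field_derivative_def]]
    by (simp add: mult.commute)
  have eq: "frechet_derivative (\<lambda>x. h (f x)) (at x) = (\<lambda>v. frechet_derivative f (at x) v * h' (f x))" for x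
    by (rule frechet_derivative_at[OF D, symmetric])
  have "Ck k (\<lambda>x. h' (f x))"
    using Suc Ck_Suc_real_iff[OF h'] by (blast dest: Ck_Suc_imp_Ck)
  with Suc.prems D show ?case
    by (auto simp: eq differentiable_def intro!: Ck_mult)
qed

text \<open>Iterated derivatives of the functions below have no convenient closed form, but they
  stay in a family stable under differentiation. On the real line the only basis direction is 1, so
  one ordinary derivative per step is enough.\<close>

lemma DERIV_coinduct_smooth:
  fixes S :: "(real \<Rightarrow> real) set"
  assumes "\<And>f. f \<in> S \<Longrightarrow> \<exists>f'\<in>S. \<forall>x. (f has_real_derivative f' x) (at x)" "f \<in> S"
  shows "smooth f"
  unfolding smooth_def
proof (intro allI Ck_coinduct[where S = S])
  fix f and i :: real and x :: real assume "f \<in> S"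
  with assms obtain f' where f': "f' \<in> S" "\<And>x. (f has_real_derivative f' x) (at x)" by blast
  then show "f differentiable at x" by (auto simp: real_differentiable_def)
  show "(\<lambda>x. frechet_derivative f (at x) i) \<in> S" if "i \<in> Basis"
    using that f' by (simp add: frechet_derivative_real[OF f'(2)])
qed (fact assms)

section \<open>Smooth cut-offs and their products with real powers\<close>

text \<open>The classical smooth, non-analytic function: all its derivatives vanish at 0. Composed
  with a quadratic that is positive exactly on an interval, it gives a bump on that
  interval.\<close>

definition flat :: "real \<Rightarrow> real" where
  "flat y = (if y > 0 then exp (- 1 / y) else 0)"

lemma tendsto_poly_mult_exp_minus_at_top:
  "((\<lambda>y::real. poly p y * exp (- y)) \<longlongrightarrow> 0) at_top"
proof -
  have 1: "((\<lambda>y. coeff p i * (y ^ i * exp (- y))) \<longlongrightarrow> 0) at_top" for i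
    using tendsto_power_div_exp_0[of i]
    by (intro tendsto_mult_right_zero) (simp add: exp_minus divide_inverse)
  have "((\<lambda>y. \<Sum>i\<le>degree p. coeff p i * (y ^ i * exp (- y))) \<longlongrightarrow> 0) at_top"
    using 1 by (rule tendsto_null_sum)
  then show ?thesis by (simp add: poly_altdef sum_distrib_right mult.assoc)
qed

text \<open>With z = 1/y one has dz/dy = -z^2, so the derivative of p(z) exp(-z) is z^2 (p - p')(z)
  exp(-z). This is the origin of \<open>q\<close>, and it shows that polynomials in 1/y times
  \<open>flat\<close> form a family closed under differentiation.\<close>

lemma DERIV_poly_inverse_mult_flat:
  fixes p :: "real poly"
  defines "q \<equiv> (monom 1 2 * (p - pderiv p))"
  shows "((\<lambda>y. poly p (inverse y) * flat y) has_real_derivative poly q (inverse x) * flat x) (at x)"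
proof -
  consider "x < 0" | "x > 0" | "x = 0" by linarith
  then show ?thesis
  proof cases
    case 1
    then have "((\<lambda>y. 0) has_real_derivative poly q (inverse x) * flat x) (at x)"
      by (simp add: flat_def)
    then show ?thesis
      by (rule has_field_derivative_transform_within[where d = "- x"])
        (use 1 in \<open>auto simp: flat_def dist_real_def\<close>)
  next
    case 2
    have "((\<lambda>y. poly p (inverse y) * exp (- 1 / y)) has_real_derivative poly q (inverse x) * exp (- 1 / x)) (at x)"
      using 2 unfolding q_def
      by (auto intro!: derivative_eq_intros DERIV_chain2[OF poly_DERIV]
          simp: poly_monom field_simps power2_eq_square)
    then have "((\<lambda>y. poly p (inverse y) * exp (- 1 / y)) has_real_derivative poly q (inverse x) * flat x) (at x)"
      using 2 by (simp add: flat_def)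
    then show ?thesis
      by (rule has_field_derivative_transform_within[where d = x])
        (use 2 in \<open>auto simp: flat_def dist_real_def\<close>)
  next
    case 3
    have "((\<lambda>y. poly p (inverse y) * flat y / y) \<longlongrightarrow> 0) (at 0)"
    proof (rule filterlim_split_at)
      show "((\<lambda>y. poly p (inverse y) * flat y / y) \<longlongrightarrow> 0) (at_left 0)"
        by (rule tendsto_eventually) (auto simp: flat_def eventually_at_filter)
      \<comment> \<open>The difference quotient at 0 carries one more factor 1/y, which turns
        \<open>p\<close> into \<open>pCons 0 p\<close>. Substituting z = 1/y moves the limit to
        infinity, where the exponential wins.\<close>
      have "((\<lambda>y. poly (pCons 0 p) (inverse y) * exp (- inverse y)) \<longlongrightarrow> 0) (at_right 0)"
        by (rule filterlim_compose[OF tendsto_poly_mult_exp_minus_at_top filterlim_inverse_at_top_right])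
      then show "((\<lambda>y. poly p (inverse y) * flat y / y) \<longlongrightarrow> 0) (at_right 0)"
        by (rule Lim_transform_eventually)
          (auto simp: flat_def eventually_at_filter divide_inverse mult_ac)
    qed
    then show ?thesis
      by (simp add: 3 DERIV_def) (simp add: flat_def)
  qed
qed

lemma smooth_flat: "smooth flat"
proof (rule DERIV_coinduct_smooth[where S = "range (\<lambda>p y. poly p (inverse y) * flat y)"])
  show "flat \<in> range (\<lambda>p y. poly p (inverse y) * flat y)"
    by (rule image_eqI[where x = 1]) auto
next
  fix f assume "f \<in> range (\<lambda>p y. poly p (inverse y) * flat y)"
  then obtain p where "f = (\<lambda>y. poly p (inverse y) * flat y)" by blast
  then show "\<exists>f'\<in>range (\<lambda>p y. poly p (inverse y) * flat y). \<forall>x. (f has_real_derivative f' x) (at x)"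
    using DERIV_poly_inverse_mult_flat[of p] by (intro bexI[OF _ rangeI]) blast
qed

lemma flat_bounds: "0 \<le> flat y" "flat y \<le> 1"
  by (auto simp: flat_def)

lemma smooth_antiderivative:
  fixes f :: "real \<Rightarrow> real"
  assumes "\<And>x. (f has_real_derivative f' x) (at x)" "smooth f'"
  shows "smooth f"
  unfolding smooth_def
proof
  show "Ck k f" for k
    using Ck_Suc_real_iff[OF assms(1)] assms(2) by (auto simp: smooth_def intro: Ck_Suc_imp_Ck)
qed

lemma smooth_real_derivative:
  fixes f :: "real \<Rightarrow> real"
  assumes "smooth f"
  obtains f' where "\<And>x. (f has_real_derivative f' x) (at x)" "smooth f'"
proof -
  from assms have "\<forall>x. f differentiable at x"
    unfolding smooth_def by (metis Ck.simps(2))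
  then obtain f' where f': "\<And>x. (f has_real_derivative f' x) (at x)"
    by (auto simp: real_differentiable_def) metis
  with assms have "smooth f'"
    using Ck_Suc_real_iff[OF f'] unfolding smooth_def by blast
  with f' show thesis by (rule that)
qed

text \<open>The bad behaviour of \<open>s powr a\<close> at and below the origin is hidden by a
  factor that vanishes up to \<open>e\<close>. The derivative is written as a power times a new
  factor, so that it has the same shape as the original function.\<close>

lemma DERIV_powr_mult:
  fixes h :: "real \<Rightarrow> real"
  assumes e: "e > 0" and h: "\<And>s. s \<le> e \<Longrightarrow> h s = 0"
    and h': "\<And>x. (h has_real_derivative h' x) (at x)"
  shows "((\<lambda>s. s powr a * h s) has_real_derivative x powr (a - 1) * (a * h x + x * h' x)) (at x)"
    and "s < e \<Longrightarrow> h' s = 0"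
proof -
  show h'0: "h' s = 0" if "s < e" for s
  proof -
    have "((\<lambda>s. 0) has_real_derivative h' s) (at s)"
      by (rule has_field_derivative_transform_within[OF h'[of s], where d = "e - s"])
        (use that h in \<open>auto simp: dist_real_def\<close>)
    then show ?thesis using DERIV_const DERIV_unique by blast
  qed
  show "((\<lambda>s. s powr a * h s) has_real_derivative x powr (a - 1) * (a * h x + x * h' x)) (at x)"
  proof (cases "x < e")
    case True
    then have "((\<lambda>s. 0) has_real_derivative x powr (a - 1) * (a * h x + x * h' x)) (at x)"
      by (simp add: h h'0)
    then show ?thesis
      by (rule has_field_derivative_transform_within[where d = "e - x"])
        (use True h in \<open>auto simp: dist_real_def\<close>)
  next
    case False
    with e have "x > 0" by simp
    then have "((\<lambda>s. s powr a * h s) has_real_derivative a * x powr (a - 1) * h x + h' x * x powr a) (at x)"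
      by (intro DERIV_mult has_real_derivative_powr h')
    moreover have "x powr a = x powr (a - 1) * x"
      using \<open>x > 0\<close> by (simp add: powr_diff)
    ultimately show ?thesis by (simp add: algebra_simps)
  qed
qed

lemma smooth_powr_mult:
  fixes h :: "real \<Rightarrow> real"
  assumes e: "e > 0" and h: "\<And>s. s \<le> e \<Longrightarrow> h s = 0" and "smooth h"
  shows "smooth (\<lambda>s. s powr a * h s)"
proof -
  let ?S = "{\<lambda>s. s powr a * h s | a h. smooth h \<and> (\<exists>e>0. \<forall>s\<le>e. h s = 0)}"
  show ?thesis
  proof (rule DERIV_coinduct_smooth[where S = ?S])
    fix f assume "f \<in> ?S"
    then obtain a h e where f: "f = (\<lambda>s. s powr a * h s)" and h: "smooth h"
      and e: "e > 0" "\<And>s. s \<le> e \<Longrightarrow> h s = 0" by blast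
    obtain h' where h': "\<And>x. (h has_real_derivative h' x) (at x)" "smooth h'"
      using smooth_real_derivative[OF h] by blast
    have "smooth (\<lambda>x. a * h x + x * h' x)"
      using h h'(2) Ck_ident unfolding smooth_def by (auto intro!: Ck_add Ck_mult Ck_const)
    \<comment> \<open>The derivative \<open>h'\<close> is known to vanish only for
      \<open>s < e\<close>, while the family asks for a closed half-line; \<open>e / 2\<close>
      leaves room.\<close>
    moreover have "\<forall>s\<le>e/2. a * h s + s * h' s = 0"
      using DERIV_powr_mult(2)[OF e h'(1)] e by auto
    ultimately have "(\<lambda>x. x powr (a - 1) * (a * h x + x * h' x)) \<in> ?S"
      using e(1)
      by (intro CollectI exI[of _ "a - 1"] exI[of _ "\<lambda>x. a * h x + x * h' x"] conjI exI[of _ "e / 2"] refl)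
        simp_all
    then show "\<exists>f'\<in>?S. \<forall>x. (f has_real_derivative f' x) (at x)"
      by (rule bexI[rotated]) (simp add: f DERIV_powr_mult(1)[OF e h'(1)])
  next
    show "(\<lambda>s. s powr a * h s) \<in> ?S"
      by (intro CollectI exI[of _ a] exI[of _ h] conjI exI[of _ e] refl) (simp_all add: assms)
  qed
qed

subsection \<open>Integration in the squared radius\<close>

lemma unit_ball_vol_neq_0 [simp]: "unit_ball_vol (real n) \<noteq> 0"
  using unit_ball_vol_pos[of "real n"] by (simp del: unit_ball_vol_pos)

text \<open>
  The radial variable is \<open>s = x \<bullet> x\<close> rather than \<open>norm x\<close>, so that radial test functions
  are smooth functions of a polynomial.
\<close>

lemma distr_inner_self:
  "distr lborel borel (\<lambda>x::'a::euclidean_space. x \<bullet> x) =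
   density lborel (\<lambda>s. ennreal (indicator {0..} s * (real DIM('a) * unit_ball_vol DIM('a) / 2 * s powr (real DIM('a) / 2 - 1))))"
  (is "?M = ?D")
\<comment> \<open>The preimage of \<open>{..s}\<close> is a ball of radius \<open>sqrt s\<close>, so
  both measures agree on half-lines. These generate the Borel sets and have finite measure.\<close>
proof (rule measure_eqI_generator_eq[where E = "range (\<lambda>s. {..s})" and A = "\<lambda>n. {..real n}" and \<Omega> = UNIV])
  let ?N = "real DIM('a)" and ?w = "unit_ball_vol DIM('a)"
  show "Int_stable (range (\<lambda>s::real. {..s}))"
    by (auto simp: Int_stable_def)
  have M: "emeasure ?M {..s} = ennreal (?w * s powr (?N / 2))" if "s \<ge> 0" for s
  proof -
    have "emeasure ?M {..s} = emeasure lborel ((\<lambda>x::'a. x \<bullet> x) -` {..s} \<inter> space lborel)"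
      by (rule emeasure_distr) auto
    also have "(\<lambda>x::'a. x \<bullet> x) -` {..s} \<inter> space lborel = cball 0 (sqrt s)"
      using that by (auto simp: norm_eq_sqrt_inner)
    also have "emeasure lborel \<dots> = ennreal (?w * sqrt s ^ DIM('a))"
      using that by (simp add: emeasure_cball)
    also have "sqrt s ^ DIM('a) = s powr (?N / 2)"
    proof (cases "s = 0")
      case False
      with that have "sqrt s ^ DIM('a) = (s powr (1/2)) powr ?N"
        by (simp add: powr_half_sqrt powr_realpow)
      then show ?thesis by (simp add: powr_powr)
    qed simp
    finally show ?thesis .
  qed
  show "emeasure ?M X = emeasure ?D X" if X: "X \<in> range (\<lambda>s. {..s})" for X
  proof -
    from X obtain s where s: "X = {..s}" by blast
    have D: "emeasure ?D X = (\<integral>\<^sup>+t. ennreal (indicator {0..s} t * (?N * ?w / 2 * t powr (?N / 2 - 1))) \<partial>lborel)"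
      unfolding s by (subst emeasure_density) (auto intro!: nn_integral_cong split: split_indicator)
    show ?thesis
    proof (cases "s \<ge> 0")
      case True
      have "((\<lambda>t. t powr (?N / 2 - 1)) has_integral (s powr (?N / 2 - 1 + 1) / (?N / 2 - 1 + 1))) {0..s}"
        using True by (intro has_integral_powr_from_0) (auto simp: field_simps)
      from has_integral_mult_right[OF this, of "?N * ?w / 2"]
      have "((\<lambda>t. ?N * ?w / 2 * t powr (?N / 2 - 1)) has_integral ?w * s powr (?N / 2)) {0..s}"
        by (simp add: field_simps)
      then have "((\<lambda>t. indicator {0..s} t * (?N * ?w / 2 * t powr (?N / 2 - 1))) has_integral ?w * s powr (?N / 2)) UNIV"
        by (subst (asm) has_integral_restrict_UNIV[symmetric])
          (erule has_integral_eq_rhs[OF has_integral_eq[rotated]]; auto simp: indicator_def)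
      then have "emeasure ?D X = ennreal (?w * s powr (?N / 2))"
        unfolding D by (intro nn_integral_has_integral_lborel) (auto simp: indicator_def)
      with M[OF True] s show ?thesis by simp
    next
      case False
      then have "(\<lambda>x::'a. x \<bullet> x) -` {..s} = {}" by (auto intro: order_trans[OF inner_ge_zero])
      then show ?thesis using False D s by (auto simp: emeasure_distr)
    qed
  qed
  show "emeasure ?M {..real n} \<noteq> \<infinity>" for n using M[of "real n"] by simp
  have "sets borel = sigma_sets UNIV (range (\<lambda>s::real. {..s}))"
    by (subst borel_eq_atMost) (simp add: sets_measure_of)
  then show "sets ?M = sigma_sets UNIV (range (\<lambda>s. {..s}))" "sets ?D = sigma_sets UNIV (range (\<lambda>s. {..s}))"
    by simp_all
  show "(\<Union>n. {..real n}) = UNIV" using real_arch_simple by auto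
qed auto

lemma norm_powr_eq_inner_powr: "norm x powr a = (x \<bullet> x) powr (a / 2)"
proof -
  have "norm x = (x \<bullet> x) powr (1 / 2)"
    by (simp add: norm_eq_sqrt_inner powr_half_sqrt)
  then show ?thesis by (simp only: powr_powr) simp
qed

text \<open>In the variable s the weight is s^(1 - N/2), the reciprocal of the power in the density
  of the squared radius, so a plain Lebesgue integral remains. The point \<open>s = 0\<close> is
  excluded because \<open>0 powr a\<close> is 0 and the two powers do not cancel there.\<close>

lemma nn_integral_inner_self:
  fixes f :: "real \<Rightarrow> ennreal"
  assumes [measurable]: "f \<in> borel_measurable borel"
  shows "(\<integral>\<^sup>+(x::'a::euclidean_space). f (x \<bullet> x) * ennreal (norm x powr (2 - real DIM('a))) \<partial>lborel)
    = ennreal (real DIM('a) * unit_ball_vol DIM('a) / 2) * (\<integral>\<^sup>+s. f s * indicator {0<..} s \<partial>lborel)"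
proof -
  let ?N = "real DIM('a)" and ?w = "unit_ball_vol DIM('a)"
  have *: "s powr (?N / 2 - 1) * s powr (1 - ?N / 2) = 1" if "s > 0" for s :: real
    using that by (simp add: powr_add[symmetric])
  have "(\<integral>\<^sup>+(x::'a). f (x \<bullet> x) * ennreal (norm x powr (2 - ?N)) \<partial>lborel)
      = (\<integral>\<^sup>+s. f s * ennreal (s powr (1 - ?N / 2)) \<partial>distr lborel borel (\<lambda>x::'a. x \<bullet> x))"
    by (subst nn_integral_distr) (auto simp: norm_powr_eq_inner_powr diff_divide_distrib)
  also have "\<dots> = (\<integral>\<^sup>+s. ennreal (?N * ?w / 2) * (f s * indicator {0<..} s) \<partial>lborel)"
    unfolding distr_inner_self
  proof (subst nn_integral_density; (rule nn_integral_cong | measurable)?)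
    fix s :: real
    show "ennreal (indicator {0..} s * (?N * ?w / 2 * s powr (?N / 2 - 1))) * (f s * ennreal (s powr (1 - ?N / 2)))
      = ennreal (?N * ?w / 2) * (f s * indicator {0<..} s)"
    proof (cases "s > 0")
      case True
      have "ennreal (?N * ?w / 2 * s powr (?N / 2 - 1)) * ennreal (s powr (1 - ?N / 2)) = ennreal (?N * ?w / 2)"
        using *[OF True] by (subst ennreal_mult[symmetric]) (auto simp: mult.assoc)
      with True show ?thesis by (simp add: mult_ac)
    qed (auto simp: indicator_def)
  qed
  finally show ?thesis by (simp add: nn_integral_cmult)
qed

text \<open>The law of the squared radius has a density with respect to \<open>lborel\<close>, so
  null sets of squared radii pull back to null sets of points.\<close>

lemma AE_inner_self:
  assumes "AE s in lborel. s > 0 \<longrightarrow> P s"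
  shows "AE x::'a::euclidean_space in lborel. x \<noteq> 0 \<longrightarrow> P (x \<bullet> x)"
proof -
  have "AE s in distr lborel borel (\<lambda>x::'a. x \<bullet> x). s > 0 \<longrightarrow> P s"
    unfolding distr_inner_self by (subst AE_density) (use assms in auto)
  from AE_distrD[OF _ this] show ?thesis by simp
qed

lemma integral_inner_self:
  fixes f :: "real \<Rightarrow> real"
  assumes [measurable]: "f \<in> borel_measurable borel"
  shows "(\<integral>(x::'a::euclidean_space). f (x \<bullet> x) * norm x powr (2 - real DIM('a)) \<partial>lborel)
    = real DIM('a) * unit_ball_vol DIM('a) / 2 * (\<integral>s. indicator {0<..} s * f s \<partial>lborel)"
proof -
  let ?N = "real DIM('a)" and ?w = "unit_ball_vol DIM('a)"
  have *: "s powr (?N / 2 - 1) * s powr (1 - ?N / 2) = 1" if "s > 0" for s :: real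
    using that by (simp add: powr_add[symmetric])
  have "(\<integral>(x::'a). f (x \<bullet> x) * norm x powr (2 - ?N) \<partial>lborel)
      = (\<integral>s. f s * s powr (1 - ?N / 2) \<partial>distr lborel borel (\<lambda>x::'a. x \<bullet> x))"
    by (subst integral_distr) (auto simp: norm_powr_eq_inner_powr diff_divide_distrib)
  also have "\<dots> = (\<integral>s. (?N * ?w / 2) * (indicator {0<..} s * f s) \<partial>lborel)"
    unfolding distr_inner_self
  proof (subst integral_density, goal_cases)
    case 4
    show ?case
    proof (rule Bochner_Integration.integral_cong[OF refl])
      fix s :: real
      show "(indicator {0..} s * (?N * ?w / 2 * s powr (?N / 2 - 1))) *\<^sub>R (f s * s powr (1 - ?N / 2))
        = (?N * ?w / 2) * (indicator {0<..} s * f s)"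
      proof (cases "s > 0")
        case True
        have "(indicator {0..} s * (?N * ?w / 2 * s powr (?N / 2 - 1))) *\<^sub>R (f s * s powr (1 - ?N / 2))
          = (?N * ?w / 2) * f s * (s powr (?N / 2 - 1) * s powr (1 - ?N / 2))"
          using True by simp
        then show ?thesis using True by (simp only: *) simp
      qed (auto simp: indicator_def)
    qed
  qed auto
  finally show ?thesis by simp
qed

text \<open>
  Lebesgue measurability of a radial function does not directly give a measurable profile, since the
  profile lives on a null set of rays. By Fubini along dilations, \<open>u\<close> agrees almost everywhere on
  almost every ray with a Borel representative; one such ray provides \<open>V\<close>.
\<close>

lemma radial_borel_profile:
  fixes u :: "'a::euclidean_space \<Rightarrow> real"
  assumes rad: "radially_symmetric u" and meas: "u \<in> borel_measurable lebesgue"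
  obtains V where "V \<in> borel_measurable borel"
    and "AE s in lborel. s > 0 \<longrightarrow> (\<forall>x. x \<bullet> x = s \<longrightarrow> u x = V s)"
proof -
  from completion_ex_borel_measurable_real[OF meas]
  obtain v where [measurable]: "v \<in> borel_measurable borel" and "AE x in lborel. u x = v x"
    by auto
  then obtain Z where Z: "Z \<in> null_sets lborel" "\<And>x. x \<notin> Z \<Longrightarrow> u x = v x"
    by (auto elim!: AE_E3)
  have [measurable]: "Z \<in> sets borel" using Z(1) by auto
  have scale: "AE x in lborel. sqrt t *\<^sub>R x \<notin> Z" if "t > 0" for t
  proof -
    have "AE x in lborel. x \<notin> Z" using Z(1) by (rule AE_not_in)
    then show ?thesis
      by (subst (asm) lborel_affine[of "sqrt t" 0]) (use that in \<open>auto simp: AE_density AE_distr_iff\<close>)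
  qed
  have dil: "(\<lambda>p. sqrt (fst p) *\<^sub>R snd p) \<in> borel_measurable (lborel \<Otimes>\<^sub>M (lborel :: 'a measure))"
    by measurable
  have pred: "{p \<in> space (lborel \<Otimes>\<^sub>M (lborel :: 'a measure)). fst p > 0 \<longrightarrow> sqrt (fst p) *\<^sub>R snd p \<notin> Z}
      \<in> sets (lborel \<Otimes>\<^sub>M lborel)"
    by (intro sets.sets_Collect_imp sets.sets_Collect_neg measurable_sets_Collect[OF dil]
        measurable_sets_Collect[OF measurable_fst''[OF measurable_ident_sets]]) auto
  have "AE t in lborel. AE x in lborel. t > 0 \<longrightarrow> sqrt t *\<^sub>R x \<notin> Z"
    using scale by auto
  then have "AE x in lborel. AE t in lborel. t > 0 \<longrightarrow> sqrt t *\<^sub>R x \<notin> Z"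
    using pred by (subst (asm) lborel_pair.AE_commute) (auto simp: split_beta')
  then have ev: "AE x in lborel. x \<noteq> 0 \<and> (AE t in lborel. t > 0 \<longrightarrow> sqrt t *\<^sub>R x \<notin> Z)"
    using AE_lborel_singleton[of "0::'a"] by auto
  have "ae_filter (lborel :: 'a measure) \<noteq> bot"
    by (simp add: ae_filter_eq_bot_iff)
  from eventually_happens'[OF this ev] obtain x0 :: 'a
    where x0: "x0 \<noteq> 0" "AE t in lborel. t > 0 \<longrightarrow> sqrt t *\<^sub>R x0 \<notin> Z" by blast
  \<comment> \<open>The point \<open>sqrt t *\<^sub>R x0\<close> has squared radius
    \<open>t * c\<close>. Hence squared radius \<open>s\<close> is met at \<open>t = s / c\<close>,
    an affine change of variable that preserves null sets.\<close>
  define c where "c = x0 \<bullet> x0"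
  have c: "c > 0" using x0 by (simp add: c_def)
  have "AE s in lborel. 0 + (1 / c) * s > 0 \<longrightarrow> sqrt (0 + (1 / c) * s) *\<^sub>R x0 \<notin> Z"
    by (rule AE_borel_affine) (use c x0 in auto)
  then have "AE s in lborel. s > 0 \<longrightarrow> (\<forall>x. x \<bullet> x = s \<longrightarrow> u x = v (sqrt (s / c) *\<^sub>R x0))"
  proof eventually_elim
    case (elim s)
    show ?case
    proof (intro impI allI)
      fix x :: 'a assume s: "s > 0" "x \<bullet> x = s"
      have "norm x = norm (sqrt (s / c) *\<^sub>R x0)"
        using s c by (simp add: norm_eq_sqrt_inner real_sqrt_divide flip: c_def)
      with rad have "u x = u (sqrt (s / c) *\<^sub>R x0)" by (auto simp: radially_symmetric_def)
      also have "\<dots> = v (sqrt (s / c) *\<^sub>R x0)" using elim s c by (intro Z) simp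
      finally show "u x = v (sqrt (s / c) *\<^sub>R x0)" .
    qed
  qed
  then show thesis by (rule that[rotated]) measurable
qed

subsection \<open>The weak formulation for the profile\<close>

text \<open>The quadratic is positive exactly on \<open>(a, a + h)\<close> when
  \<open>c > 0\<close>, and a large \<open>c\<close> pushes the bump towards the indicator of that
  interval. The upper bound \<open>h\<close> comes from the mean value theorem, since the bump never
  exceeds 1. Allowing \<open>c = 0\<close> lets \<open>c\<close> run through all
  \<open>real n\<close>.\<close>

lemma bump_primitive:
  fixes a h c :: real
  assumes "h > 0" "c \<ge> 0"
  obtains K where "\<And>s. (K has_real_derivative flat (c * ((s - a) * (a + h - s)))) (at s)" "smooth K"
    "\<And>s. s \<le> a \<Longrightarrow> K s = 0" "\<And>s. s \<ge> a + h \<Longrightarrow> K s = K (a + h)" "\<And>s. 0 \<le> K s" "\<And>s. K s \<le> h"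
proof -
  let ?k = "\<lambda>s. flat (c * ((s - a) * (a + h - s)))"
  have "Ck m (\<lambda>s. c * ((s + - a) * ((a + h) + (-1) * s)))" for m
    by (intro Ck_mult Ck_add Ck_const Ck_ident)
  then have "Ck m (\<lambda>s. c * ((s - a) * (a + h - s)))" for m by simp
  then have "Ck m ?k" for m
    by (rule Ck_compose[OF smooth_flat[unfolded smooth_def, rule_format]])
  then have k: "smooth ?k" by (simp add: smooth_def)
  then have "Ck 0 ?k" unfolding smooth_def by blast
  then have "isCont ?k s" for s
    by (simp add: continuous_on_eq_continuous_at)
  then obtain L where L: "\<And>s. (L has_vector_derivative ?k s) (at s)"
    using einterval_antiderivative[of "-\<infinity>" "\<infinity>" ?k] by auto
  define K where "K s = L s - L a" for s
  have K: "(K has_real_derivative ?k s) (at s)" for s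
    using L[of s] unfolding K_def has_real_derivative_iff_has_vector_derivative[symmetric]
    by (auto intro!: derivative_eq_intros)
  have k0: "?k s = 0" if "s \<le> a \<or> s \<ge> a + h" for s
  proof -
    have "(s - a) * (a + h - s) \<le> 0" using that assms by (auto simp: mult_le_0_iff)
    then have "c * ((s - a) * (a + h - s)) \<le> 0" using assms by (simp add: mult_nonneg_nonpos)
    then show ?thesis by (simp add: flat_def)
  qed
  have mono: "K s \<le> K t" if "s \<le> t" for s t
    using that K flat_bounds by (intro DERIV_nonneg_imp_nondecreasing[of s t K]) auto
  have const: "K s = K t" if "s < t" "\<And>x. s < x \<Longrightarrow> x < t \<Longrightarrow> ?k x = 0" for s t
  proof (rule DERIV_isconst2[symmetric, of s t K t])
    show "continuous_on {s..t} K"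
      using K by (intro continuous_at_imp_continuous_on) (blast intro: DERIV_isCont)
    show "(K has_real_derivative 0) (at x)" if "s < x" "x < t" for x
      using K[of x] \<open>\<And>x. s < x \<Longrightarrow> x < t \<Longrightarrow> ?k x = 0\<close>[OF that] by simp
  qed (use \<open>s < t\<close> in auto)
  have left: "K s = 0" if "s \<le> a" for s
    using const[of s a] k0 that by (cases "s = a") (auto simp: K_def)
  have right: "K s = K (a + h)" if "s \<ge> a + h" for s
    using const[of "a + h" s] k0 that by (cases "s = a + h") auto
  have "K (a + h) - K a \<le> h"
  proof -
    obtain z where "K (a + h) - K a = (a + h - a) * ?k z"
      using MVT2[of a "a + h" K ?k] K assms by auto
    then show ?thesis using flat_bounds assms by (simp add: mult_left_le)
  qed
  then have top: "K (a + h) \<le> h" using left by simp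
  have "0 \<le> K s" for s using mono[of a s] left[of s] left[of a] by (cases "s \<le> a") auto
  moreover have "K s \<le> h" for s
    using mono[of s "a + h"] right[of s] top by (cases "s \<le> a + h") auto
  ultimately show thesis
    using that[OF K smooth_antiderivative[OF K k] left right] by blast
qed

section \<open>Measurability and integrability away from the origin\<close>

lemma L1_loc_punct_measurable:
  fixes u :: "'a::euclidean_space \<Rightarrow> real"
  assumes "L1_loc_punct u"
  shows "u \<in> borel_measurable lebesgue"
proof -
  \<comment> \<open>These shells exhaust the punctured space, which gives measurability there as a
    pointwise limit. The value at the origin is added back on a singleton.\<close>
  let ?K = "\<lambda>n::nat. cball 0 (real n) - ball (0::'a) (1 / real (Suc n))"
  have "compact (?K n)" "0 \<notin> ?K n" for n
    by (auto intro: compact_diff)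
  then have "set_integrable lebesgue (?K n) u" for n
    using assms by (auto simp: L1_loc_punct_def)
  then have meas: "(\<lambda>x. indicator (?K n) x *\<^sub>R u x) \<in> borel_measurable lebesgue" for n
    by (auto simp: set_integrable_def)
  have lim: "(\<lambda>n. indicator (?K n) x *\<^sub>R u x) \<longlonglongrightarrow> indicator (- {0}) x *\<^sub>R u x" for x
  proof (cases "x = 0")
    case False
    obtain n1 where n1: "norm x \<le> real n1" using real_arch_simple by blast
    obtain n2 where n2: "1 / real (Suc n2) < norm x" using False nat_approx_posE[of "norm x"] by auto
    have "x \<in> ?K n" if "n \<ge> max n1 n2" for n
    proof -
      have "1 / real (Suc n) \<le> 1 / real (Suc n2)" using that by (intro divide_left_mono) auto
      with n1 n2 that show ?thesis by (auto simp: not_less)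
    qed
    then have "eventually (\<lambda>n. indicator (?K n) x *\<^sub>R u x = indicator (- {0}) x *\<^sub>R u x) sequentially"
      using False by (intro eventually_sequentiallyI[of "max n1 n2"]) auto
    then show ?thesis by (rule tendsto_eventually)
  qed simp
  have "(\<lambda>x. indicator (- {0}) x *\<^sub>R u x) \<in> borel_measurable lebesgue"
    by (rule borel_measurable_LIMSEQ_real[OF lim meas])
  then have "(\<lambda>x. indicator (- {0}) x *\<^sub>R u x + indicator {0} x * u 0) \<in> borel_measurable lebesgue"
    by (intro borel_measurable_add borel_measurable_times borel_measurable_indicator) auto
  also have "(\<lambda>x. indicator (- {0}) x *\<^sub>R u x + indicator {0} x * u 0) = u"
    by (auto simp: indicator_def)
  finally show ?thesis .
qed

text \<open>Both bounds refer to the squared radius, matching the argument of the profile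
  \<open>V\<close>.\<close>

definition annulus :: "real \<Rightarrow> real \<Rightarrow> 'a::euclidean_space set" where
  "annulus a b = {x. a \<le> x \<bullet> x \<and> x \<bullet> x \<le> b}"

lemma closed_annulus: "closed (annulus a b)"
  unfolding annulus_def by (intro closed_Collect_conj closed_Collect_le continuous_intros)

lemma compact_annulus: "compact (annulus a b)"
proof -
  have "bounded (annulus a b :: 'a set)"
    by (rule boundedI[of _ "sqrt b"]) (auto simp: annulus_def norm_eq_sqrt_inner)
  with closed_annulus show ?thesis by (simp add: compact_eq_bounded_closed)
qed

lemma L1_loc_punct_annulus:
  fixes u :: "'a::euclidean_space \<Rightarrow> real"
  assumes "L1_loc_punct u" "0 < a"
  shows "set_integrable lebesgue (annulus a b) (\<lambda>x. norm x powr c * u x)"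
proof -
  have "0 \<notin> (annulus a b :: 'a set)" using assms by (auto simp: annulus_def)
  then have int: "set_integrable lebesgue (annulus a b) u"
    using assms compact_annulus by (auto simp: L1_loc_punct_def)
  have meas [measurable]: "u \<in> borel_measurable lebesgue" by (rule L1_loc_punct_measurable) fact
  have ann [measurable]: "annulus a b \<in> sets (lebesgue :: 'a measure)"
    by (intro sets_completionI_sets) (simp add: closed_annulus)
  have norm_meas [measurable]: "(\<lambda>x::'a. norm x powr c) \<in> borel_measurable lebesgue"
    by (rule measurable_completion) auto
  \<comment> \<open>A power is monotone in the radius, in a direction given by the sign of
    \<open>c\<close>, so on the annulus it is bounded by its value at one of the two ends.\<close>
  let ?M = "max (a powr (c / 2)) (b powr (c / 2))"
  have bd: "norm x powr c \<le> ?M" if "x \<in> annulus a b" for x :: 'a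
  proof (cases "c \<ge> 0")
    case True
    then have "(x \<bullet> x) powr (c / 2) \<le> b powr (c / 2)"
      using that by (intro powr_mono2) (auto simp: annulus_def)
    then show ?thesis by (simp add: norm_powr_eq_inner_powr)
  next
    case False
    then have "(x \<bullet> x) powr (c / 2) \<le> a powr (c / 2)"
      using that assms by (intro powr_mono2') (auto simp: annulus_def)
    then show ?thesis by (simp add: norm_powr_eq_inner_powr)
  qed
  show ?thesis unfolding set_integrable_def
  proof (rule Bochner_Integration.integrable_bound)
    show "integrable lebesgue (\<lambda>x. ?M * norm (indicator (annulus a b) x *\<^sub>R u x))"
      using int unfolding set_integrable_def by (intro integrable_mult_right integrable_norm)
    show "AE x in lebesgue. norm (indicator (annulus a b) x *\<^sub>R (norm x powr c * u x))
      \<le> norm (?M * norm (indicator (annulus a b) x *\<^sub>R u x))"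
    proof (intro AE_I2)
      fix x :: 'a
      have "norm x powr c * \<bar>u x\<bar> \<le> \<bar>?M\<bar> * \<bar>u x\<bar>" if "x \<in> annulus a b"
        using bd[OF that] by (intro mult_right_mono) auto
      then show "norm (indicator (annulus a b) x *\<^sub>R (norm x powr c * u x))
        \<le> norm (?M * norm (indicator (annulus a b) x *\<^sub>R u x))"
        by (auto simp: abs_mult indicator_def)
    qed
  qed measurable
qed

text \<open>
  Testing with \<open>\<phi> x = norm x powr (1 - N) * \<Psi> (x \<bullet> x)\<close>: the weight cancels the term
  \<open>(N - 1) * \<phi> x / norm x\<close> of the divergence.
\<close>

lemma weak_form_profile:
  fixes u g :: "'a::euclidean_space \<Rightarrow> real" and V \<Psi> \<psi> :: "real \<Rightarrow> real"
  assumes W: "W11_loc u g" and V[measurable]: "V \<in> borel_measurable borel"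
    and uV: "AE x in lborel. u x = V (x \<bullet> x)"
    and \<Psi>: "\<And>s. (\<Psi> has_real_derivative \<psi> s) (at s)" "smooth \<Psi>" and \<psi>: "\<psi> \<in> borel_measurable borel"
    and a: "0 < a" "\<And>s. s \<le> a \<Longrightarrow> \<Psi> s = 0" and b: "\<And>s. s \<ge> b \<Longrightarrow> \<Psi> s = 0"
  shows "real DIM('a) * unit_ball_vol DIM('a) * (\<integral>s. indicator {0<..} s * (V s * \<psi> s) \<partial>lborel)
    = - (\<integral>x. g x * (norm x powr (1 - real DIM('a)) * \<Psi> (x \<bullet> x)) \<partial>lebesgue)"
proof -
  let ?N = "real DIM('a)" and ?w = "unit_ball_vol DIM('a)"
  define \<alpha> where "\<alpha> = (1 - ?N) / 2"
  define \<phi> where "\<phi> x = (x \<bullet> x) powr \<alpha> * \<Psi> (x \<bullet> x)" for x :: 'a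
  have [measurable]: "\<psi> \<in> borel_measurable borel" by fact
  have \<phi>_eq: "\<phi> x = norm x powr (1 - ?N) * \<Psi> (x \<bullet> x)" for x
    by (simp add: \<phi>_def \<alpha>_def norm_powr_eq_inner_powr)
  have "smooth (\<lambda>s. s powr \<alpha> * \<Psi> s)"
    using a \<Psi> by (intro smooth_powr_mult[of a])
  then have "Ck k (\<lambda>s. s powr \<alpha> * \<Psi> s)" for k by (simp add: smooth_def)
  then have "smooth \<phi>"
    unfolding smooth_def \<phi>_def[abs_def]
    by (intro allI Ck_compose[of _ "\<lambda>s. s powr \<alpha> * \<Psi> s" "\<lambda>x. x \<bullet> x"] Ck_inner_self)
  moreover have supp: "closure {x. \<phi> x \<noteq> 0} \<subseteq> annulus a b"
  proof (rule closure_minimal[OF _ closed_annulus])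
    show "{x. \<phi> x \<noteq> 0} \<subseteq> annulus a b"
      using a b by (auto simp: \<phi>_def annulus_def not_le[symmetric] simp del: not_le) (meson linear)+
  qed
  then have "compact (closure {x. \<phi> x \<noteq> 0})"
    by (metis closed_closure closed_Int_compact compact_annulus inf.absorb_iff1)
  moreover have "0 \<notin> closure {x. \<phi> x \<noteq> 0}" using supp a by (auto simp: annulus_def)
  ultimately have test: "test_fun_punct \<phi>" by (simp add: test_fun_punct_def)

  \<comment> \<open>With r = |x| the radial derivative of \<phi> is (1 - N) r^(-N) \<Psi> + 2 r^(2 -
    N) \<psi>, and the divergence term cancels its first summand. The surviving power 2 - N is the
    weight required by \<open>integral_inner_self\<close>. At the origin both sides are 0 by the
    conventions for division and \<open>powr\<close>.\<close>
  have D: "frechet_derivative \<phi> (at x) (x /\<^sub>R norm x) + (?N - 1) * \<phi> x / norm x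
      = 2 * (norm x powr (2 - ?N) * \<psi> (x \<bullet> x))" for x
  proof -
    define r where "r = norm x"
    have s: "x \<bullet> x = r * r" by (simp add: r_def dot_square_norm power2_eq_square)
    let ?d = "(r * r) powr (\<alpha> - 1) * (\<alpha> * \<Psi> (r * r) + (r * r) * \<psi> (r * r))"
    have 1: "((\<lambda>s. s powr \<alpha> * \<Psi> s) has_derivative (\<lambda>v. ?d * v)) (at (x \<bullet> x))"
      using DERIV_powr_mult(1)[OF a \<Psi>(1), of \<alpha> "x \<bullet> x"] by (simp add: has_field_derivative_def s)
    have 2: "((\<lambda>x. x \<bullet> x) has_derivative (\<lambda>v. 2 * (x \<bullet> v))) (at x)"
      by (auto intro!: derivative_eq_intros simp: inner_commute)
    have "frechet_derivative \<phi> (at x) = (\<lambda>v. ?d * (2 * (x \<bullet> v)))"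
      unfolding \<phi>_def using has_derivative_compose[OF 2 1] by (rule frechet_derivative_at[symmetric])
    then have fd: "frechet_derivative \<phi> (at x) (x /\<^sub>R norm x) = ?d * (2 * r)"
      by (cases "r = 0") (simp_all add: s r_def[symmetric])
    show ?thesis
    proof (cases "r = 0")
      case False
      then have r: "r > 0" by (simp add: r_def)
      have e1: "(r * r) powr (\<alpha> - 1) = r powr (- ?N) / r"
        using r by (simp add: powr_mult powr_add[symmetric] \<alpha>_def field_simps powr_diff powr_minus)
      have e2: "r powr (1 - ?N) = r powr (- ?N) * r" "r powr (2 - ?N) = r powr (- ?N) * (r * r)"
        using r by (simp_all add: powr_diff powr_minus field_simps power2_eq_square)
      have \<phi>x: "\<phi> x = r powr (1 - ?N) * \<Psi> (r * r)" by (simp only: \<phi>_eq s r_def)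
      show ?thesis
        unfolding fd unfolding \<phi>x s r_def[symmetric] unfolding e1 e2 unfolding \<alpha>_def using r by (simp add: field_simps)
    next
      case True
      then show ?thesis unfolding fd by (simp add: r_def)
    qed
  qed
  have nm: "(\<lambda>x::'a. norm x powr (2 - ?N)) \<in> borel_measurable lborel" by measurable
  have um: "u \<in> borel_measurable lebesgue" using W by (auto simp: W11_loc_def intro: L1_loc_punct_measurable)
  have "- (\<integral>x. g x * \<phi> x \<partial>lebesgue) = (\<integral>x. u x * (2 * (norm x powr (2 - ?N) * \<psi> (x \<bullet> x))) \<partial>lebesgue)"
    using W test unfolding W11_loc_def radial_deriv_def D[symmetric] by simp
  also have "\<dots> = (\<integral>(x::'a). V (x \<bullet> x) * (2 * (norm x powr (2 - ?N) * \<psi> (x \<bullet> x))) \<partial>lebesgue)"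
  proof (rule Bochner_Integration.integral_cong_AE)
    show "AE x in lebesgue. u x * (2 * (norm x powr (2 - ?N) * \<psi> (x \<bullet> x))) = V (x \<bullet> x) * (2 * (norm x powr (2 - ?N) * \<psi> (x \<bullet> x)))"
      using uV unfolding AE_completion_iff by eventually_elim simp
    have "(\<lambda>x::'a. 2 * (norm x powr (2 - ?N) * \<psi> (x \<bullet> x))) \<in> borel_measurable lebesgue"
      by (rule measurable_completion) measurable
    with um show "(\<lambda>x. u x * (2 * (norm x powr (2 - ?N) * \<psi> (x \<bullet> x)))) \<in> borel_measurable lebesgue" by measurable
    show "(\<lambda>x::'a. V (x \<bullet> x) * (2 * (norm x powr (2 - ?N) * \<psi> (x \<bullet> x)))) \<in> borel_measurable lebesgue"
      by (rule measurable_completion) measurable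
  qed
  also have "\<dots> = (\<integral>(x::'a). V (x \<bullet> x) * (2 * (norm x powr (2 - ?N) * \<psi> (x \<bullet> x))) \<partial>lborel)"
    by (rule integral_completion) measurable
  also have "\<dots> = 2 * (\<integral>(x::'a). (V (x \<bullet> x) * \<psi> (x \<bullet> x)) * norm x powr (2 - ?N) \<partial>lborel)"
    by (subst Bochner_Integration.integral_mult_right_zero[symmetric]) (simp add: mult_ac)
  also have "\<dots> = ?N * ?w * (\<integral>s. indicator {0<..} s * (V s * \<psi> s) \<partial>lborel)"
    by (subst integral_inner_self[where f = "\<lambda>s. V s * \<psi> s"]) simp_all
  finally show ?thesis by (simp add: \<phi>_eq)
qed

text \<open>The integral of |V| over \<open>{a..b}\<close> is, up to the factor N \<omega> / 2, the
  integral of |u| against |x|^(2 - N) over an annulus, where that weight is bounded.\<close>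

lemma profile_set_integrable:
  fixes u :: "'a::euclidean_space \<Rightarrow> real" and V :: "real \<Rightarrow> real"
  assumes u: "L1_loc_punct u" and V[measurable]: "V \<in> borel_measurable borel"
    and uV: "AE x in lborel. u x = V (x \<bullet> x)" and a: "0 < a"
  shows "set_integrable lborel {a..b} V"
proof -
  let ?N = "real DIM('a)" and ?w = "unit_ball_vol DIM('a)"
  let ?f = "\<lambda>s. ennreal (indicator {a..b} s * \<bar>V s\<bar>)"
  have "integrable lebesgue (\<lambda>x. indicator (annulus a b) x *\<^sub>R (norm x powr (2 - ?N) * u x))"
    using L1_loc_punct_annulus[OF u a, of b "2 - ?N"] by (simp add: set_integrable_def)
  then have "(\<integral>\<^sup>+x. ennreal (norm (indicator (annulus a b) x *\<^sub>R (norm x powr (2 - ?N) * u x))) \<partial>lebesgue) < \<infinity>"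
    by (simp add: integrable_iff_bounded)
  also have "(\<integral>\<^sup>+x. ennreal (norm (indicator (annulus a b) x *\<^sub>R (norm x powr (2 - ?N) * u x))) \<partial>lebesgue)
    = (\<integral>\<^sup>+(x::'a). ?f (x \<bullet> x) * ennreal (norm x powr (2 - ?N)) \<partial>lebesgue)"
    using uV by (intro nn_integral_cong_AE, unfold AE_completion_iff, eventually_elim)
      (auto simp: indicator_def annulus_def abs_mult ennreal_mult'[symmetric] mult_ac)
  also have "\<dots> = (\<integral>\<^sup>+(x::'a). ?f (x \<bullet> x) * ennreal (norm x powr (2 - ?N)) \<partial>lborel)"
    by (rule nn_integral_completion)
  also have "\<dots> = ennreal (?N * ?w / 2) * (\<integral>\<^sup>+s. ?f s * indicator {0<..} s \<partial>lborel)"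
    by (rule nn_integral_inner_self) measurable
  finally have "(\<integral>\<^sup>+s. ?f s * indicator {0<..} s \<partial>lborel) < \<infinity>"
    by (auto simp: ennreal_mult_less_top)
  also have "(\<integral>\<^sup>+s. ?f s * indicator {0<..} s \<partial>lborel) = (\<integral>\<^sup>+s. ennreal (norm (indicator {a..b} s *\<^sub>R V s)) \<partial>lborel)"
    using a by (intro nn_integral_cong) (auto simp: indicator_def)
  finally show ?thesis
    unfolding set_integrable_def integrable_iff_bounded by simp
qed

text \<open>
  The primitive of \<open>k s - k (s - (b - a))\<close>, for a bump \<open>k\<close> approximating the indicator
  of \<open>(a, a + h)\<close>, lies between \<open>0\<close> and \<open>h\<close> and is supported in \<open>[a, b + h]\<close>.
\<close>

lemma profile_average_diff:
  fixes u g :: "'a::euclidean_space \<Rightarrow> real" and V :: "real \<Rightarrow> real"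
  assumes W: "W11_loc u g" and V[measurable]: "V \<in> borel_measurable borel"
    and uV: "AE x in lborel. u x = V (x \<bullet> x)" and ab: "0 < a" "a < b" and h: "0 < h"
  shows "real DIM('a) * unit_ball_vol DIM('a) *
      \<bar>(\<integral>s\<in>{a<..<a+h}. V s \<partial>lborel) - (\<integral>s\<in>{b<..<b+h}. V s \<partial>lborel)\<bar>
    \<le> h * (\<integral>x\<in>annulus a (b + h). norm x powr (1 - real DIM('a)) * \<bar>g x\<bar> \<partial>lebesgue)"
proof -
  let ?N = "real DIM('a)" and ?w = "unit_ball_vol DIM('a)"
  let ?k = "\<lambda>n s. flat (real n * ((s - a) * (a + h - s)))"
  let ?f = "\<lambda>n s. indicator {0<..} s * (V s * (?k n s - ?k n (s - (b - a))))"
  let ?l = "\<lambda>s. indicator {a<..<a+h} s *\<^sub>R V s - indicator {b<..<b+h} s *\<^sub>R V s"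
  let ?J = "\<integral>x\<in>annulus a (b + h). norm x powr (1 - ?N) * \<bar>g x\<bar> \<partial>lebesgue"
  have g: "L1_loc_punct g" and u: "L1_loc_punct u" using W by (auto simp: W11_loc_def)
  have gm [measurable]: "g \<in> borel_measurable lebesgue" by (rule L1_loc_punct_measurable) fact
  have nm: "(\<lambda>x::'a. norm x powr (1 - ?N)) \<in> borel_measurable lebesgue"
    by (rule measurable_completion) measurable
  have Jint: "integrable lebesgue (\<lambda>x. indicator (annulus a (b + h)) x * (norm x powr (1 - ?N) * \<bar>g x\<bar>))"
    using integrable_abs[OF L1_loc_punct_annulus[OF g ab(1), of "b + h" "1 - ?N", unfolded set_integrable_def]]
    by (simp add: abs_mult)
  have [measurable]: "flat \<in> borel_measurable borel"
    unfolding flat_def by measurable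
  have km: "?k n \<in> borel_measurable borel" for n by measurable
  have k0: "?k n s = 0" if "\<not> (a < s \<and> s < a + h)" for n s
  proof -
    have "(s - a) * (a + h - s) \<le> 0" using that h by (auto simp: mult_le_0_iff not_less)
    then have "real n * ((s - a) * (a + h - s)) \<le> 0" by (simp add: mult_nonneg_nonpos)
    then show ?thesis by (simp add: flat_def)
  qed
  \<comment> \<open>Inside the interval the argument of \<open>flat\<close> grows linearly in n, so
    the value tends to exp(0) = 1; outside, every term is 0.\<close>
  have klim: "(\<lambda>n. ?k n s) \<longlonglongrightarrow> indicator {a<..<a+h} s" for s
  proof (cases "a < s \<and> s < a + h")
    case True
    then have pos: "(s - a) * (a + h - s) > 0" by simp
    have "(\<lambda>n. exp (- (inverse ((s - a) * (a + h - s)) * inverse (real n)))) \<longlonglongrightarrow> exp (- (inverse ((s - a) * (a + h - s)) * 0))"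
      by (intro tendsto_intros lim_inverse_n)
    then have "(\<lambda>n. exp (- 1 / (real n * ((s - a) * (a + h - s))))) \<longlonglongrightarrow> 1"
      by (simp add: field_simps)
    moreover have "eventually (\<lambda>n. exp (- 1 / (real n * ((s - a) * (a + h - s)))) = ?k n s) sequentially"
      using eventually_gt_at_top[of 0] by eventually_elim (use pos in \<open>simp add: flat_def\<close>)
    ultimately show ?thesis using True by (auto intro: Lim_transform_eventually)
  next
    case False
    then have "?k n s = 0" for n by (rule k0)
    then show ?thesis using False by (auto simp: indicator_def)
  qed
  \<comment> \<open>The bound does not depend on n: however steep the bump is, its test function is
    at most \<open>h\<close> in absolute value and vanishes outside the same annulus. Only the left
    side has to pass to the limit.\<close>
  have bound: "\<bar>?N * ?w * (\<integral>s. ?f n s \<partial>lborel)\<bar> \<le> h * ?J" for n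
  proof -
    obtain K where K: "\<And>s. (K has_real_derivative ?k n s) (at s)" "smooth K"
      "\<And>s. s \<le> a \<Longrightarrow> K s = 0" "\<And>s. s \<ge> a + h \<Longrightarrow> K s = K (a + h)" "\<And>s. 0 \<le> K s" "\<And>s. K s \<le> h"
      using bump_primitive[OF h, of "real n" a] by auto
    define \<Psi> where "\<Psi> s = K s - K (s - (b - a))" for s
    have mono: "K s \<le> K t" if "s \<le> t" for s t
      using that K(1) flat_bounds by (intro DERIV_nonneg_imp_nondecreasing[of s t K]) auto
    have \<Psi>0: "\<Psi> s = 0" if "s \<le> a \<or> s \<ge> b + h" for s
    proof (cases "s \<le> a")
      case False
      then have "K s = K (a + h)" "K (s - (b - a)) = K (a + h)"
        using that ab by (auto intro!: K(4))
      then show ?thesis by (simp add: \<Psi>_def)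
    qed (use ab K(3) in \<open>auto simp: \<Psi>_def\<close>)
    have \<Psi>h: "\<bar>\<Psi> s\<bar> \<le> h" for s
      using K(5,6)[of s] K(5,6)[of "s - (b - a)"] by (auto simp: \<Psi>_def)
    have D: "(\<Psi> has_real_derivative (?k n s - ?k n (s - (b - a)))) (at s)" for s
    proof -
      have "((\<lambda>s. K (s - (b - a))) has_real_derivative ?k n (s - (b - a)) * 1) (at s)"
        by (rule DERIV_chain2[OF K(1)]) (auto intro!: derivative_eq_intros)
      then show ?thesis unfolding \<Psi>_def using DERIV_diff[OF K(1)] by simp
    qed
    have "smooth \<Psi>"
    proof -
      have K2: "Ck m K" for m using K(2) by (simp add: smooth_def)
      have "Ck m (\<lambda>s. K (s + - (b - a)))" for m
        by (rule Ck_compose[OF K2]) (intro Ck_add Ck_const Ck_ident)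
      then have "Ck m (\<lambda>s. K s + (-1) * K (s + - (b - a)))" for m
        by (rule Ck_add[OF K2 Ck_mult[OF Ck_const]])
      then show ?thesis by (simp add: smooth_def \<Psi>_def[abs_def] algebra_simps)
    qed
    then have "?N * ?w * (\<integral>s. ?f n s \<partial>lborel) = - (\<integral>x. g x * (norm x powr (1 - ?N) * \<Psi> (x \<bullet> x)) \<partial>lebesgue)"
      using \<Psi>0 by (intro weak_form_profile[OF W V uV D _ _ ab(1), where b = "b + h"]) auto
    then have "\<bar>?N * ?w * (\<integral>s. ?f n s \<partial>lborel)\<bar> = \<bar>\<integral>x. g x * (norm x powr (1 - ?N) * \<Psi> (x \<bullet> x)) \<partial>lebesgue\<bar>"
      by simp
    also have "\<dots> \<le> (\<integral>x. h * (indicator (annulus a (b + h)) x * (norm x powr (1 - ?N) * \<bar>g x\<bar>)) \<partial>lebesgue)"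
    proof (rule order_trans[OF integral_abs_bound Bochner_Integration.integral_mono_AE'])
      show "AE x in lebesgue. \<bar>g x * (norm x powr (1 - ?N) * \<Psi> (x \<bullet> x))\<bar>
        \<le> h * (indicator (annulus a (b + h)) x * (norm x powr (1 - ?N) * \<bar>g x\<bar>))"
      proof (rule AE_I2)
        fix x :: 'a
        show "\<bar>g x * (norm x powr (1 - ?N) * \<Psi> (x \<bullet> x))\<bar>
          \<le> h * (indicator (annulus a (b + h)) x * (norm x powr (1 - ?N) * \<bar>g x\<bar>))"
        proof (cases "x \<in> annulus a (b + h)")
          case True
          have "\<bar>\<Psi> (x \<bullet> x)\<bar> * (norm x powr (1 - ?N) * \<bar>g x\<bar>) \<le> h * (norm x powr (1 - ?N) * \<bar>g x\<bar>)"
            by (intro mult_right_mono \<Psi>h) auto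
          with True show ?thesis by (simp add: abs_mult mult_ac)
        next
          case False
          then have "\<Psi> (x \<bullet> x) = 0" by (intro \<Psi>0) (auto simp: annulus_def)
          then show ?thesis using h by simp
        qed
      qed
    qed (use Jint h in \<open>auto intro!: AE_I2\<close>)
    also have "\<dots> = h * ?J" by (simp add: set_lebesgue_integral_def)
    finally show ?thesis .
  qed
  have lim: "(\<lambda>n. \<integral>s. ?f n s \<partial>lborel) \<longlonglongrightarrow> (\<integral>s. ?l s \<partial>lborel)"
  proof (rule integral_dominated_convergence[where w = "\<lambda>s. \<bar>indicator {a..b+h} s *\<^sub>R V s\<bar>"])
    show "integrable lborel (\<lambda>s. \<bar>indicator {a..b+h} s *\<^sub>R V s\<bar>)"
      using profile_set_integrable[OF u V uV ab(1), of "b + h"]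
      unfolding set_integrable_def by (rule integrable_abs)
    show "AE s in lborel. (\<lambda>n. ?f n s) \<longlonglongrightarrow> ?l s"
    proof (rule AE_I2)
      fix s
      have "(\<lambda>n. ?f n s) \<longlonglongrightarrow> indicator {0<..} s * (V s * (indicator {a<..<a+h} s - indicator {a<..<a+h} (s - (b - a))))"
        by (intro tendsto_intros klim)
      also have "indicator {0<..} s * (V s * (indicator {a<..<a+h} s - indicator {a<..<a+h} (s - (b - a)))) = ?l s"
        using ab h by (auto simp: indicator_def)
      finally show "(\<lambda>n. ?f n s) \<longlonglongrightarrow> ?l s" .
    qed
    show "AE s in lborel. norm (?f n s) \<le> \<bar>indicator {a..b+h} s *\<^sub>R V s\<bar>" for n
    proof (rule AE_I2)
      fix s
      show "norm (?f n s) \<le> \<bar>indicator {a..b+h} s *\<^sub>R V s\<bar>"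
      proof (cases "s \<in> {a..b+h}")
        case True
        have "\<bar>?k n s - ?k n (s - (b - a))\<bar> \<le> 1"
          using flat_bounds[of "real n * ((s - a) * (a + h - s))"]
            flat_bounds[of "real n * (((s - (b - a)) - a) * (a + h - (s - (b - a))))"] by linarith
        then have "\<bar>V s\<bar> * \<bar>?k n s - ?k n (s - (b - a))\<bar> \<le> \<bar>V s\<bar>"
          by (intro mult_left_le) auto
        then show ?thesis using True ab by (simp add: abs_mult)
      next
        case False
        have "?k n s = 0" by (rule k0) (use False ab in auto)
        moreover have "?k n (s - (b - a)) = 0" by (rule k0) (use False ab in auto)
        ultimately show ?thesis by simp
      qed
    qed
  qed measurable
  have "(\<lambda>n. \<bar>?N * ?w * (\<integral>s. ?f n s \<partial>lborel)\<bar>) \<longlonglongrightarrow> \<bar>?N * ?w * (\<integral>s. ?l s \<partial>lborel)\<bar>"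
    by (intro tendsto_intros lim)
  then have "\<bar>?N * ?w * (\<integral>s. ?l s \<partial>lborel)\<bar> \<le> h * ?J"
    by (rule LIMSEQ_le_const2) (use bound in blast)
  moreover have "(\<integral>s. ?l s \<partial>lborel) = (\<integral>s\<in>{a<..<a+h}. V s \<partial>lborel) - (\<integral>s\<in>{b<..<b+h}. V s \<partial>lborel)"
  proof -
    have "set_integrable lborel {c<..<c+h} V" if "0 < c" for c
      using profile_set_integrable[OF u V uV that, of "c + h"] by (rule set_integrable_subset) auto
    with ab show ?thesis
      unfolding set_lebesgue_integral_def set_integrable_def by (intro Bochner_Integration.integral_diff) auto
  qed
  ultimately show ?thesis by (simp add: abs_mult)
qed

section \<open>From averages to values of the profile\<close>

lemma lebesgue_differentiation_at_right:
  fixes V :: "real \<Rightarrow> real"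
  assumes "\<And>a b. 0 < a \<Longrightarrow> set_integrable lborel {a..b} V"
  obtains Z where "Z \<in> null_sets lborel"
    "\<And>x. 0 < x \<Longrightarrow> x \<notin> Z \<Longrightarrow> ((\<lambda>h. (\<integral>s\<in>{x<..<x+h}. V s \<partial>lborel) / h) \<longlongrightarrow> V x) (at_right 0)"
proof -
  \<comment> \<open>The profile need not be integrable near 0. Each cut-off is integrable on every
    bounded interval, and near a given \<open>x > 0\<close> it agrees with \<open>V\<close> once
    \<open>1 / real (Suc m) < x\<close>; countably many exceptional sets are then united.\<close>
  let ?f = "\<lambda>m s. indicator {1 / real (Suc m)..} s * V s"
  have int: "?f m integrable_on cbox a b" for m a b
  proof -
    have "set_integrable lborel {1 / real (Suc m)..b} V" by (rule assms) simp
    then have "integrable lborel (\<lambda>s. indicator {a..b} s *\<^sub>R (indicator {1 / real (Suc m)..b} s *\<^sub>R V s))"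
      unfolding set_integrable_def by (rule integrable_mult_indicator[rotated]) simp
    also have "(\<lambda>s. indicator {a..b} s *\<^sub>R (indicator {1 / real (Suc m)..b} s *\<^sub>R V s))
        = (\<lambda>s. indicator {a..b} s *\<^sub>R ?f m s)"
      by (auto simp: indicator_def)
    finally have "set_integrable lborel {a..b} (?f m)"
      unfolding set_integrable_def .
    from set_borel_integral_eq_integral(1)[OF this] show ?thesis by simp
  qed
  define Q where "Q m Z \<longleftrightarrow> negligible Z \<and> (\<forall>x e. x \<notin> Z \<longrightarrow> 0 < e \<longrightarrow> (\<exists>d>0. \<forall>h. 0 < h \<and> h < d \<longrightarrow>
      norm (integral (cbox x (x + h *\<^sub>R One)) (?f m) /\<^sub>R h ^ DIM(real) - ?f m x) < e))" for m Z
  have "\<exists>Z. Q m Z" for m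
  proof (rule integrable_ccontinuous_explicit[OF int[of m]])
    fix Z assume "negligible Z" "\<And>x e. x \<notin> Z \<Longrightarrow> 0 < e \<Longrightarrow> \<exists>d>0. \<forall>h. 0 < h \<and> h < d \<longrightarrow>
        norm (integral (cbox x (x + h *\<^sub>R One)) (?f m) /\<^sub>R h ^ DIM(real) - ?f m x) < e"
    then show ?thesis unfolding Q_def by blast
  qed
  then obtain Zm where "\<And>m. Q m (Zm m)" by metis
  then have Zm: "\<And>m. negligible (Zm m)"
    "\<And>m x e. x \<notin> Zm m \<Longrightarrow> 0 < e \<Longrightarrow> \<exists>d>0. \<forall>h. 0 < h \<and> h < d \<longrightarrow>
      norm (integral (cbox x (x + h *\<^sub>R One)) (?f m) /\<^sub>R h ^ DIM(real) - ?f m x) < e"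
    unfolding Q_def by blast+
  have "(\<Union>m. Zm m) \<in> null_sets lebesgue"
    using Zm(1) by (intro null_sets_UN) (simp add: negligible_iff_null_sets)
  then obtain Z where Z: "Z \<in> null_sets lborel" "(\<Union>m. Zm m) \<subseteq> Z"
    by (auto simp: null_sets_completion_iff2)
  show thesis
  proof (rule that[OF Z(1)])
    fix x assume x: "0 < x" "x \<notin> Z"
    obtain m where m: "1 / real (Suc m) < x" using x nat_approx_posE by metis
    have eq: "integral (cbox x (x + h *\<^sub>R One)) (?f m) /\<^sub>R h ^ DIM(real) = (\<integral>s\<in>{x<..<x+h}. V s \<partial>lborel) / h"
      if "h > 0" for h
    proof -
      have "integral (cbox x (x + h *\<^sub>R One)) (?f m) = integral {x..x+h} V"
        using m by (intro trans[OF _ Henstock_Kurzweil_Integration.integral_cong[of "{x..x+h}" "?f m" V]]) (auto simp: indicator_def)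
      also have "\<dots> = integral {x<..<x+h} V"
        using integral_open_interval_real[of x "x + h" V] by simp
      also have "\<dots> = (\<integral>s\<in>{x<..<x+h}. V s \<partial>lborel)"
        by (rule set_borel_integral_eq_integral(2)[symmetric])
          (rule set_integrable_subset[OF assms[of x "x + h"]]; use x in auto)
      finally show ?thesis by (simp add: divide_inverse_commute)
    qed
    show "((\<lambda>h. (\<integral>s\<in>{x<..<x+h}. V s \<partial>lborel) / h) \<longlongrightarrow> V x) (at_right 0)"
    proof (rule tendstoI)
      fix e :: real assume "e > 0"
      with Zm(2)[of x m e] Z(2) x(2) obtain d where d: "d > 0" "\<And>h. 0 < h \<Longrightarrow> h < d \<Longrightarrow>
        norm (integral (cbox x (x + h *\<^sub>R One)) (?f m) /\<^sub>R h ^ DIM(real) - ?f m x) < e" by blast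
      have "eventually (\<lambda>h. 0 < h \<and> h < d) (at_right 0)"
        using d(1) by (auto simp: eventually_at_right_field intro!: exI[of _ d])
      then show "\<forall>\<^sub>F h in at_right 0. dist ((\<integral>s\<in>{x<..<x+h}. V s \<partial>lborel) / h) (V x) < e"
      proof eventually_elim
        case (elim h)
        with d(2)[of h] eq[of h] m show ?case by (simp add: dist_norm)
      qed
    qed
  qed
qed

text \<open>The comparison of averages is divided by \<open>h\<close>, and \<open>h\<close> tends to
  0. Averages at \<open>b\<close> look to the right and reach \<open>b + h\<close>, hence the slack
  \<open>c > b\<close>. The null set \<open>Z\<close> is the one from differentiation, so it does
  not depend on \<open>c\<close>.\<close>

lemma profile_diff_AE:
  fixes u g :: "'a::euclidean_space \<Rightarrow> real" and V :: "real \<Rightarrow> real"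
  assumes W: "W11_loc u g" and V[measurable]: "V \<in> borel_measurable borel"
    and uV: "AE x in lborel. u x = V (x \<bullet> x)"
  obtains Z where "Z \<in> null_sets lborel"
    "\<And>a b c. 0 < a \<Longrightarrow> a < b \<Longrightarrow> b < c \<Longrightarrow> a \<notin> Z \<Longrightarrow> b \<notin> Z \<Longrightarrow>
      ennreal (real DIM('a) * unit_ball_vol DIM('a) * \<bar>V a - V b\<bar>)
        \<le> (\<integral>\<^sup>+x. indicator (annulus a c) x * ennreal (norm x powr (1 - real DIM('a)) * \<bar>g x\<bar>) \<partial>lebesgue)"
proof -
  let ?N = "real DIM('a)" and ?w = "unit_ball_vol DIM('a)"
  have g: "L1_loc_punct g" and u: "L1_loc_punct u" using W by (auto simp: W11_loc_def)
  obtain Z where Z: "Z \<in> null_sets lborel"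
    "\<And>x. 0 < x \<Longrightarrow> x \<notin> Z \<Longrightarrow> ((\<lambda>h. (\<integral>s\<in>{x<..<x+h}. V s \<partial>lborel) / h) \<longlongrightarrow> V x) (at_right 0)"
    using lebesgue_differentiation_at_right[OF profile_set_integrable[OF u V uV]] by blast
  show thesis
  proof (rule that[OF Z(1)])
    fix a b c :: real assume abc: "0 < a" "a < b" "b < c" "a \<notin> Z" "b \<notin> Z"
    let ?I = "\<lambda>x h. \<integral>s\<in>{x<..<x+h}. V s \<partial>lborel"
    let ?k = "\<lambda>x. norm x powr (1 - ?N) * \<bar>g x\<bar>"
    have int: "integrable lebesgue (\<lambda>x. indicator (annulus a d) x * ?k x)" for d
      using integrable_abs[OF L1_loc_punct_annulus[OF g abc(1), of d "1 - ?N", unfolded set_integrable_def]]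
      by (simp add: abs_mult)
    have "((\<lambda>h. ?N * ?w * \<bar>?I a h / h - ?I b h / h\<bar>) \<longlongrightarrow> ?N * ?w * \<bar>V a - V b\<bar>) (at_right 0)"
      using abc by (intro tendsto_intros Z(2)) auto
    moreover have "eventually (\<lambda>h. 0 < h \<and> h < c - b) (at_right 0)"
      using abc by (auto simp: eventually_at_right_field intro!: exI[of _ "c - b"])
    then have "eventually (\<lambda>h. ?N * ?w * \<bar>?I a h / h - ?I b h / h\<bar> \<le> (\<integral>x. indicator (annulus a c) x * ?k x \<partial>lebesgue)) (at_right 0)"
    proof eventually_elim
      case (elim h)
      then have h: "0 < h" "b + h \<le> c" by auto
      have "h * (?N * ?w * \<bar>?I a h / h - ?I b h / h\<bar>) = ?N * ?w * \<bar>?I a h - ?I b h\<bar>"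
        using h by (simp add: diff_divide_distrib[symmetric])
      also have "\<dots> \<le> h * (\<integral>x\<in>annulus a (b + h). ?k x \<partial>lebesgue)"
        by (rule profile_average_diff[OF W V uV abc(1,2) h(1)])
      also have "(\<integral>x\<in>annulus a (b + h). ?k x \<partial>lebesgue) \<le> (\<integral>x. indicator (annulus a c) x * ?k x \<partial>lebesgue)"
        unfolding set_lebesgue_integral_def real_scaleR_def
        using int h by (intro Bochner_Integration.integral_mono) (auto simp: indicator_def annulus_def)
      finally show ?case using h by simp
    qed
    ultimately have "?N * ?w * \<bar>V a - V b\<bar> \<le> (\<integral>x. indicator (annulus a c) x * ?k x \<partial>lebesgue)"
      by (rule tendsto_upperbound) simp
    then have "ennreal (?N * ?w * \<bar>V a - V b\<bar>) \<le> ennreal (\<integral>x. indicator (annulus a c) x * ?k x \<partial>lebesgue)"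
      by (rule ennreal_leI)
    also have "\<dots> = (\<integral>\<^sup>+x. ennreal (indicator (annulus a c) x * ?k x) \<partial>lebesgue)"
      by (rule nn_integral_eq_integral[symmetric, OF int]) auto
    also have "\<dots> = (\<integral>\<^sup>+x. indicator (annulus a c) x * ennreal (?k x) \<partial>lebesgue)"
      by (intro nn_integral_cong) (auto simp: indicator_def)
    finally show "ennreal (?N * ?w * \<bar>V a - V b\<bar>) \<le> \<dots>" .
  qed
qed

subsection \<open>Tail bounds\<close>

lemma sph_mean_radial:
  fixes u :: "'a::euclidean_space \<Rightarrow> real"
  assumes "radially_symmetric u"
  shows "sph_mean (\<lambda>x. \<bar>u x\<bar>) (norm y) = \<bar>u y\<bar>"
proof -
  \<comment> \<open>At \<open>x = 0\<close> the direction \<open>x /\<^sub>R norm x\<close> is 0, so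
    \<open>u 0\<close> appears in place of \<open>u y\<close>; the correction lives on a single
    point.\<close>
  have eq: "indicator (ball (0::'a) 1) x *\<^sub>R \<bar>u (norm y *\<^sub>R (x /\<^sub>R norm x))\<bar>
      = indicator (ball 0 1) x *\<^sub>R \<bar>u y\<bar> + indicator {0} x *\<^sub>R (\<bar>u 0\<bar> - \<bar>u y\<bar>)" for x
  proof (cases "x = 0")
    case False
    then have "norm (norm y *\<^sub>R (x /\<^sub>R norm x)) = norm y" by simp
    then have "u (norm y *\<^sub>R (x /\<^sub>R norm x)) = u y"
      using assms unfolding radially_symmetric_def by blast
    then show ?thesis using False by simp
  qed simp
  have "(\<integral>x\<in>ball (0::'a) 1. \<bar>u (norm y *\<^sub>R (x /\<^sub>R norm x))\<bar> \<partial>lebesgue)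
    = measure lebesgue (ball (0::'a) 1) * \<bar>u y\<bar>"
    unfolding set_lebesgue_integral_def eq
    by (subst Bochner_Integration.integral_add) (auto simp: lmeasurable_iff_integrable[symmetric] intro: lmeasurable_compact)
  then show ?thesis
    by (simp add: sph_mean_def sphere_integral_def omega_def content_ball)
qed

text \<open>Continuity turns one small value of \<open>F\<close> into a nonempty open set of small
  values, which cannot lie inside the null set where \<open>P\<close> fails. This is how the lower
  limit of the spherical means reaches points where they equal |V|.\<close>

lemma AE_point_in_sublevel:
  fixes F :: "real \<Rightarrow> real"
  assumes F: "continuous_on {0<..} F" and P: "AE t in lborel. 0 < t \<longrightarrow> P t"
    and t0: "t0 \<in> U" "0 < t0" "F t0 < e" and U: "open U"
  obtains t where "t \<in> U" "0 < t" "F t < e" "P t"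
proof -
  let ?S = "U \<inter> {t \<in> {0<..}. F t \<in> {..<e}}"
  have "open {t \<in> {0<..}. F t \<in> {..<e}}"
    using continuous_open_preimage[OF F, of "{..<e}"] by (simp add: vimage_def Int_def)
  then have "open ?S" using U by blast
  moreover have "t0 \<in> ?S" using t0 by simp
  ultimately have nn: "\<not> negligible ?S" using open_not_negligible by blast
  obtain Z where Z: "Z \<in> null_sets lborel" "\<And>t. t \<notin> Z \<Longrightarrow> 0 < t \<longrightarrow> P t"
    using P by (auto elim!: AE_E3)
  then have "negligible Z" by (simp add: negligible_iff_null_sets null_sets_completionI)
  then have "\<not> ?S \<subseteq> Z" using nn negligible_subset by blast
  then obtain t where t: "t \<in> ?S" "t \<notin> Z" by blast
  show thesis by (rule that[of t]) (use t Z(2) in auto)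
qed

lemma Liminf_zero_frequently:
  fixes f :: "'b \<Rightarrow> real"
  assumes "Liminf A (\<lambda>t. ereal (f t)) = 0" "e > 0"
  shows "\<exists>\<^sub>F t in A. f t < e"
proof (rule ccontr)
  assume "\<not> ?thesis"
  then have "\<forall>\<^sub>F t in A. ereal e \<le> ereal (f t)"
    by (simp add: not_frequently not_less)
  then have "ereal e \<le> Liminf A (\<lambda>t. ereal (f t))" by (rule Liminf_bounded)
  with assms show False by simp
qed

lemma AE_profile_of_mean:
  fixes u :: "'a::euclidean_space \<Rightarrow> real"
  assumes rad: "radially_symmetric u" and uV: "AE s in lborel. s > 0 \<longrightarrow> (\<forall>x. x \<bullet> x = s \<longrightarrow> u x = V s)"
    and Z: "Z \<in> null_sets lborel"
    and F: "AE t in lborel. t > 0 \<longrightarrow> F t = sph_mean (\<lambda>x. \<bar>u x\<bar>) t"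
  shows "AE t in lborel. t > 0 \<longrightarrow> F t = \<bar>V (t * t)\<bar> \<and> t * t \<notin> Z"
proof -
  have "AE s in lborel. s > 0 \<longrightarrow> (\<forall>x. x \<bullet> x = s \<longrightarrow> u x = V s) \<and> s \<notin> Z"
    using uV AE_not_in[OF Z] by eventually_elim auto
  \<comment> \<open>On the real line the squared radius of \<open>t\<close> is \<open>t * t\<close>,
    so statements about almost every squared radius become statements about almost every
    radius.\<close>
  from AE_inner_self[where 'a = real, OF this]
  have "AE t in lborel. t \<noteq> 0 \<longrightarrow> (\<forall>x. x \<bullet> x = t * t \<longrightarrow> u x = V (t * t)) \<and> t * t \<notin> Z"
    by simp
  with F show ?thesis
  proof eventually_elim
    case (elim t)
    obtain e :: 'a where "e \<in> Basis" using nonempty_Basis by blast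
    then have e: "norm (t *\<^sub>R e) = t" "(t *\<^sub>R e) \<bullet> (t *\<^sub>R e) = t * t" if "t > 0"
      using that by (simp_all add: inner_Basis)
    show ?case using elim e sph_mean_radial[OF rad, of "t *\<^sub>R e"] by auto
  qed
qed

text \<open>The Boolean selects the exterior or the interior of a ball, so that decay at infinity
  and decay at the origin share one argument. The threshold is a squared radius.\<close>

definition tail_set :: "bool \<Rightarrow> real \<Rightarrow> 'a::euclidean_space set" where
  "tail_set up a = {x. if up then a \<le> x \<bullet> x else x \<bullet> x \<le> a}"

lemma tail_set_borel [measurable]: "tail_set up a \<in> sets borel"
  by (cases up) (simp_all add: tail_set_def)

text \<open>
  For the upper tail the bound holds with \<open>c = a\<close>; for the lower tail it is only obtained for
  every \<open>c > a\<close>, because the averages in the weak formulation are taken to the right of \<open>a\<close>.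
\<close>

lemma profile_tail_bound:
  fixes u g :: "'a::euclidean_space \<Rightarrow> real"
  defines "T \<equiv> \<lambda>up c. (\<integral>\<^sup>+x. indicator (tail_set up c) x * ennreal (norm x powr (1 - real DIM('a)) * \<bar>g x\<bar>) \<partial>lebesgue)"
  assumes rad: "radially_symmetric u" and W: "W11_loc u g" and V[measurable]: "V \<in> borel_measurable borel"
    and uV: "AE s in lborel. s > 0 \<longrightarrow> (\<forall>x. x \<bullet> x = s \<longrightarrow> u x = V s)"
    and lim: "if up then W11_minus u else W11_plus u"
  shows "AE a in lborel. a > 0 \<longrightarrow> (\<forall>c. (if up then c = a else a < c) \<longrightarrow>
      ennreal (real DIM('a) * unit_ball_vol DIM('a) * \<bar>V a\<bar>) \<le> T up c)"
proof -
  let ?w = "real DIM('a) * unit_ball_vol DIM('a)"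
  have w: "?w > 0" by simp
  have "AE x::'a in lborel. u x = V (x \<bullet> x)"
    using AE_inner_self[OF uV] AE_lborel_singleton[of "0::'a"] by eventually_elim auto
  from profile_diff_AE[OF W V this] obtain Z where Z: "Z \<in> null_sets lborel"
    and diff: "\<And>a b c. 0 < a \<Longrightarrow> a < b \<Longrightarrow> b < c \<Longrightarrow> a \<notin> Z \<Longrightarrow> b \<notin> Z \<Longrightarrow> ennreal (?w * \<bar>V a - V b\<bar>)
        \<le> (\<integral>\<^sup>+x. indicator (annulus a c) x * ennreal (norm x powr (1 - real DIM('a)) * \<bar>g x\<bar>) \<partial>lebesgue)"
    by blast
  have bound: "ennreal (?w * \<bar>V a\<bar>) \<le> T up c" if a: "a > 0" "a \<notin> Z" and c: "if up then c = a else a < c" for a c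
  proof (rule ennreal_le_epsilon)
    fix e :: real assume e: "e > 0"
    \<comment> \<open>The tolerance \<open>e / ?w\<close> costs exactly \<open>e\<close> after
      multiplication by \<open>?w\<close> in the triangle inequality.\<close>
    have near: "\<exists>t>0. (if up then a < t * t else t * t < a) \<and> t * t \<notin> Z \<and> \<bar>V (t * t)\<bar> < e / ?w"
    proof (cases up)
      case True
      with lim obtain F where F: "continuous_on {0<..} F"
        "AE t in lborel. t > 0 \<longrightarrow> F t = sph_mean (\<lambda>x. \<bar>u x\<bar>) t" "Liminf at_top (\<lambda>t. ereal (F t)) = 0"
        by (auto simp: W11_minus_def)
      have "\<exists>\<^sub>F t in at_top. F t < e / ?w"
        using F(3) e w by (intro Liminf_zero_frequently) (auto intro!: divide_pos_pos)
      from frequently_eventually_frequently[OF this eventually_gt_at_top[of "sqrt a"]]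
      obtain t0 where t0: "t0 > sqrt a" "F t0 < e / ?w"
        by (auto dest!: frequently_ex)
      obtain t where t: "t \<in> {sqrt a<..}" "0 < t" "F t < e / ?w" "F t = \<bar>V (t * t)\<bar> \<and> t * t \<notin> Z"
        by (rule AE_point_in_sublevel[OF F(1) AE_profile_of_mean[OF rad uV Z F(2)], of t0 "{sqrt a<..}" "e / ?w"])
          (use t0 a in \<open>auto intro: less_trans[of 0 "sqrt a"]\<close>)
      have "sqrt a < t" using t(1) by simp
      then have "sqrt a * sqrt a < t * t" using a t(2) by (intro mult_strict_mono) auto
      with t a True show ?thesis by (intro exI[of _ t]) auto
    next
      case False
      with lim obtain F where F: "continuous_on {0<..} F"
        "AE t in lborel. t > 0 \<longrightarrow> F t = sph_mean (\<lambda>x. \<bar>u x\<bar>) t" "Liminf (at_right 0) (\<lambda>t. ereal (F t)) = 0"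
        by (auto simp: W11_plus_def)
      have "\<exists>\<^sub>F t in at_right 0. F t < e / ?w"
        using F(3) e w by (intro Liminf_zero_frequently) (auto intro!: divide_pos_pos)
      moreover have "\<forall>\<^sub>F t in at_right 0. 0 < t \<and> t < sqrt a"
        using a by (auto simp: eventually_at_right_field intro!: exI[of _ "sqrt a"])
      ultimately have "\<exists>\<^sub>F t in at_right 0. F t < e / ?w \<and> 0 < t \<and> t < sqrt a"
        by (rule frequently_eventually_frequently)
      then obtain t0 where t0: "0 < t0" "t0 < sqrt a" "F t0 < e / ?w"
        by (auto dest!: frequently_ex)
      obtain t where t: "t \<in> {..<sqrt a}" "0 < t" "F t < e / ?w" "F t = \<bar>V (t * t)\<bar> \<and> t * t \<notin> Z"
        by (rule AE_point_in_sublevel[OF F(1) AE_profile_of_mean[OF rad uV Z F(2)], of t0 "{..<sqrt a}" "e / ?w"])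
          (use t0 a in auto)
      have "t < sqrt a" using t(1) by simp
      then have "t * t < sqrt a * sqrt a" using a t(2) by (intro mult_strict_mono) auto
      with t a False show ?thesis by (intro exI[of _ t]) auto
    qed
    then obtain t where t: "t > 0" "if up then a < t * t else t * t < a" "t * t \<notin> Z" "\<bar>V (t * t)\<bar> < e / ?w"
      by blast
    have T: "ennreal (?w * \<bar>V a - V (t * t)\<bar>) \<le> T up c"
    proof (cases up)
      case True
      \<comment> \<open>Any outer bound beyond \<open>t * t\<close> would do; the annulus lies in
        the exterior tail whatever its outer radius.\<close>
      have "ennreal (?w * \<bar>V a - V (t * t)\<bar>) \<le> (\<integral>\<^sup>+x. indicator (annulus a (t * t + 1)) x * ennreal (norm x powr (1 - real DIM('a)) * \<bar>g x\<bar>) \<partial>lebesgue)"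
        by (rule diff) (use a t True in auto)
      also have "\<dots> \<le> T up c"
        unfolding T_def using True c
        by (intro nn_integral_mono mult_right_mono) (auto simp: indicator_def annulus_def tail_set_def)
      finally show ?thesis .
    next
      case False
      \<comment> \<open>Here \<open>a\<close> is the right endpoint, so the slack of the difference
        estimate falls on the boundary of the tail itself: this is the origin of
        \<open>c > a\<close>.\<close>
      have "ennreal (?w * \<bar>V (t * t) - V a\<bar>) \<le> (\<integral>\<^sup>+x. indicator (annulus (t * t) c) x * ennreal (norm x powr (1 - real DIM('a)) * \<bar>g x\<bar>) \<partial>lebesgue)"
        by (rule diff) (use a t False c in auto)
      also have "\<dots> \<le> T up c"
        unfolding T_def using False c
        by (intro nn_integral_mono mult_right_mono) (auto simp: indicator_def annulus_def tail_set_def)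
      finally show ?thesis by (simp add: abs_minus_commute)
    qed
    have "?w * \<bar>V a\<bar> \<le> ?w * \<bar>V a - V (t * t)\<bar> + e"
    proof -
      have "?w * \<bar>V a\<bar> \<le> ?w * (\<bar>V a - V (t * t)\<bar> + e / ?w)"
        by (rule mult_left_mono) (use t(4) w in auto)
      also have "\<dots> = ?w * \<bar>V a - V (t * t)\<bar> + e" using w by (simp add: distrib_left)
      finally show ?thesis .
    qed
    then have "ennreal (?w * \<bar>V a\<bar>) \<le> ennreal (?w * \<bar>V a - V (t * t)\<bar> + e)"
      by (rule ennreal_leI)
    also have "ennreal (?w * \<bar>V a - V (t * t)\<bar> + e) = ennreal (?w * \<bar>V a - V (t * t)\<bar>) + ennreal e"
      using e by (intro ennreal_plus) auto
    also have "\<dots> \<le> T up c + ennreal e"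
      by (rule add_right_mono[OF T])
    finally show "ennreal (?w * \<bar>V a\<bar>) \<le> T up c + ennreal e" .
  qed
  show ?thesis using AE_not_in[OF Z] by eventually_elim (use bound in blast)
qed

section \<open>Hoelder's inequality and the power weight\<close>

lemma nn_integral_Holder:
  fixes f g :: "'b \<Rightarrow> real"
  assumes [measurable]: "f \<in> borel_measurable M" "g \<in> borel_measurable M"
    and nonneg: "\<And>x. 0 \<le> f x" "\<And>x. 0 \<le> g x"
    and pq: "1 < p" "1 < q" "1 / p + 1 / q = 1"
    and A: "(\<integral>\<^sup>+x. ennreal (f x powr p) \<partial>M) = ennreal A" "0 \<le> A"
    and B: "(\<integral>\<^sup>+x. ennreal (g x powr q) \<partial>M) = ennreal B" "0 < B"
  shows "(\<integral>\<^sup>+x. ennreal (f x * g x) \<partial>M) \<le> ennreal (A powr (1 / p) * B powr (1 / q))"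
proof (cases "A = 0")
  case True
  with A have "(\<integral>\<^sup>+x. ennreal (f x powr p) \<partial>M) = 0" by simp
  then have "AE x in M. ennreal (f x powr p) = 0"
    by (subst (asm) nn_integral_0_iff_AE) auto
  then have "AE x in M. ennreal (f x * g x) = 0"
    by eventually_elim simp
  then have "(\<integral>\<^sup>+x. ennreal (f x * g x) \<partial>M) = 0"
    by (subst nn_integral_0_iff_AE) auto
  then show ?thesis by simp
next
  case False
  with A have A0: "A > 0" by simp
  define \<alpha> \<beta> where "\<alpha> = A powr (1 / p)" and "\<beta> = B powr (1 / q)"
  have pos: "\<alpha> > 0" "\<beta> > 0" using A0 B by (auto simp: \<alpha>_def \<beta>_def)
  have pw: "\<alpha> powr p = A" "\<beta> powr q = B" using A0 B pq by (auto simp: \<alpha>_def \<beta>_def powr_powr)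
  \<comment> \<open>Young's inequality is applied to the functions divided by their norms \<alpha>
    and \<beta>, so that integration yields \<alpha> \<beta> (1/p + 1/q). Dividing by \<alpha> is
    why \<open>A = 0\<close> is treated separately.\<close>
  have Young: "f x * g x \<le> (\<alpha> * \<beta> / (p * A)) * f x powr p + (\<alpha> * \<beta> / (q * B)) * g x powr q" for x
  proof -
    have "f x * g x = \<alpha> * \<beta> * ((f x / \<alpha>) * (g x / \<beta>))" using pos by simp
    also have "\<dots> \<le> \<alpha> * \<beta> * ((f x / \<alpha>) powr p / p + (g x / \<beta>) powr q / q)"
      using pos nonneg pq by (intro mult_left_mono Youngs_inequality) auto
    also have "\<dots> = (\<alpha> * \<beta> / (p * A)) * f x powr p + (\<alpha> * \<beta> / (q * B)) * g x powr q"
      using pos nonneg pq by (simp add: powr_divide pw field_simps)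
    finally show ?thesis .
  qed
  have "(\<integral>\<^sup>+x. ennreal (f x * g x) \<partial>M)
      \<le> (\<integral>\<^sup>+x. ennreal (\<alpha> * \<beta> / (p * A)) * ennreal (f x powr p) + ennreal (\<alpha> * \<beta> / (q * B)) * ennreal (g x powr q) \<partial>M)"
  proof (intro nn_integral_mono)
    fix x
    have "ennreal (f x * g x) \<le> ennreal ((\<alpha> * \<beta> / (p * A)) * f x powr p + (\<alpha> * \<beta> / (q * B)) * g x powr q)"
      by (rule ennreal_leI[OF Young])
    also have "\<dots> = ennreal (\<alpha> * \<beta> / (p * A)) * ennreal (f x powr p) + ennreal (\<alpha> * \<beta> / (q * B)) * ennreal (g x powr q)"
      using pos A0 B pq by (subst ennreal_plus) (auto simp: ennreal_mult[symmetric])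
    finally show "ennreal (f x * g x) \<le> \<dots>" .
  qed
  also have "\<dots> = ennreal (\<alpha> * \<beta> / (p * A)) * ennreal A + ennreal (\<alpha> * \<beta> / (q * B)) * ennreal B"
    by (simp add: nn_integral_add nn_integral_cmult A B)
  also have "\<dots> = ennreal (\<alpha> * \<beta> / (p * A) * A + \<alpha> * \<beta> / (q * B) * B)"
    using pos A0 B pq by (subst ennreal_plus) (auto simp: ennreal_mult[symmetric])
  also have "\<alpha> * \<beta> / (p * A) * A + \<alpha> * \<beta> / (q * B) * B = \<alpha> * \<beta> * (1 / p + 1 / q)"
    using A0 B pq by (simp add: field_simps)
  finally show ?thesis using pq by (simp add: \<alpha>_def \<beta>_def)
qed

text \<open>The antiderivative s^e / e vanishes at the far end of the tail, at infinity for
  \<open>e < 0\<close> and at 0 for \<open>e > 0\<close>. Only the boundary value at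
  \<open>a\<close> remains, with the same formula in both cases.\<close>

lemma nn_integral_powr_tail:
  fixes e a :: real
  assumes "a > 0" "if up then e < 0 else e > 0"
  shows "(\<integral>\<^sup>+s. ennreal (indicator {s. if up then a \<le> s else s \<le> a} s * s powr (e - 1)) * indicator {0<..} s \<partial>lborel)
    = ennreal (a powr e / \<bar>e\<bar>)"
proof (cases up)
  case True
  with assms have e: "e < 0" by simp
  have "(\<integral>\<^sup>+s. ennreal (indicator {s. if up then a \<le> s else s \<le> a} s * s powr (e - 1)) * indicator {0<..} s \<partial>lborel)
      = (\<integral>\<^sup>+s. ennreal (s powr (e - 1)) * indicator {a..} s \<partial>lborel)"
    using assms True by (intro nn_integral_cong) (auto simp: indicator_def)
  also have "\<dots> = ennreal (0 - a powr e / e)"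
  proof (rule nn_integral_FTC_atLeast)
    show "((\<lambda>s. s powr e / e) has_real_derivative s powr (e - 1)) (at s)" if "a \<le> s" for s
      using that assms e by (auto intro!: derivative_eq_intros)
    have "((\<lambda>s. s powr e / e) \<longlongrightarrow> 0 / e) at_top"
      using e by (intro tendsto_divide tendsto_neg_powr tendsto_const filterlim_ident) auto
    then show "((\<lambda>s. s powr e / e) \<longlongrightarrow> 0) at_top" by simp
  qed auto
  finally show ?thesis using e by simp
next
  case False
  with assms have e: "e > 0" by simp
  have "((\<lambda>s. s powr (e - 1)) has_integral (a powr (e - 1 + 1) / (e - 1 + 1))) {0..a}"
    using assms e by (intro has_integral_powr_from_0) auto
  then have "((\<lambda>s. indicator {0..a} s * s powr (e - 1)) has_integral a powr e / e) UNIV"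
    by (subst (asm) has_integral_restrict_UNIV[symmetric])
      (auto simp: indicator_def if_distrib cong: if_cong elim!: has_integral_eq[rotated])
  then have "(\<integral>\<^sup>+s. ennreal (indicator {0..a} s * s powr (e - 1)) \<partial>lborel) = ennreal (a powr e / e)"
    by (intro nn_integral_has_integral_lborel) auto
  also have "(\<integral>\<^sup>+s. ennreal (indicator {0..a} s * s powr (e - 1)) \<partial>lborel)
    = (\<integral>\<^sup>+s. ennreal (indicator {s. if up then a \<le> s else s \<le> a} s * s powr (e - 1)) * indicator {0<..} s \<partial>lborel)"
    using False by (intro nn_integral_cong) (auto simp: indicator_def)
  finally show ?thesis using e by simp
qed

text \<open>The kernel splits as |x|^(1 - N) = |x|^(\<gamma> + N/q) |x|^(-\<kappa> - N/q): the first
  factor joins \<open>g\<close> and the second goes into the conjugate norm. For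
  \<open>p = 1\<close> the second factor is |x|^(-\<kappa>), whose supremum over the tail is its
  boundary value. The constant depends on neither the threshold nor the choice of tail.\<close>

lemma weighted_tail_bound:
  fixes \<gamma> p :: real
  defines "N \<equiv> real DIM('a::euclidean_space)"
  defines "\<kappa> \<equiv> N - 1 + \<gamma>"
  assumes p: "1 \<le> p"
  obtains C where "C > 0" "\<And>up a A (g :: 'a \<Rightarrow> real).
    g \<in> borel_measurable lebesgue \<Longrightarrow> 0 < a \<Longrightarrow> 0 \<le> A \<Longrightarrow>
    (if up then \<kappa> > 0 else \<kappa> < 0) \<or> p = 1 \<and> \<kappa> = 0 \<Longrightarrow>
    (\<integral>\<^sup>+x. ennreal (\<bar>norm x powr (\<gamma> + N_over_conj N p) * g x\<bar> powr p) \<partial>lebesgue) = ennreal A \<Longrightarrow>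
    (\<integral>\<^sup>+x. indicator (tail_set up a) x * ennreal (norm x powr (1 - N) * \<bar>g x\<bar>) \<partial>lebesgue)
      \<le> ennreal (C * a powr (- \<kappa> / 2) * A powr (1 / p))"
proof (cases "p = 1")
  case True
  show thesis
  proof (rule that[of 1], simp)
    fix up and a A :: real and g :: "'a \<Rightarrow> real"
    assume a: "0 < a" and \<kappa>: "(if up then \<kappa> > 0 else \<kappa> < 0) \<or> p = 1 \<and> \<kappa> = 0" and g: "g \<in> borel_measurable lebesgue"
      and A: "0 \<le> A" "(\<integral>\<^sup>+x. ennreal (\<bar>norm x powr (\<gamma> + N_over_conj N p) * g x\<bar> powr p) \<partial>lebesgue) = ennreal A"
    have gm: "(\<lambda>x. ennreal (\<bar>norm x powr \<gamma> * g x\<bar>)) \<in> borel_measurable lebesgue"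
    proof -
      have "(\<lambda>x::'a. norm x powr \<gamma>) \<in> borel_measurable lebesgue" by (rule measurable_completion) measurable
      with g show ?thesis by measurable
    qed
    have "(\<integral>\<^sup>+x. indicator (tail_set up a) x * ennreal (norm x powr (1 - N) * \<bar>g x\<bar>) \<partial>lebesgue)
      \<le> (\<integral>\<^sup>+x. ennreal (a powr (- \<kappa> / 2)) * ennreal (\<bar>norm x powr \<gamma> * g x\<bar>) \<partial>lebesgue)"
    proof (intro nn_integral_mono)
      fix x :: 'a
      show "indicator (tail_set up a) x * ennreal (norm x powr (1 - N) * \<bar>g x\<bar>)
        \<le> ennreal (a powr (- \<kappa> / 2)) * ennreal (\<bar>norm x powr \<gamma> * g x\<bar>)"
      proof (cases "x \<in> tail_set up a \<and> x \<noteq> 0")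
        case x: True
        have "(x \<bullet> x) powr (- \<kappa> / 2) \<le> a powr (- \<kappa> / 2)"
        proof (cases up)
          case True
          then show ?thesis using x \<kappa> a by (intro powr_mono2') (auto simp: tail_set_def)
        next
          case False
          then show ?thesis using x \<kappa> a by (intro powr_mono2) (auto simp: tail_set_def)
        qed
        then have "norm x powr (- \<kappa>) * (norm x powr \<gamma> * \<bar>g x\<bar>) \<le> a powr (- \<kappa> / 2) * (norm x powr \<gamma> * \<bar>g x\<bar>)"
          by (intro mult_right_mono) (auto simp: norm_powr_eq_inner_powr)
        moreover have "norm x powr (1 - N) = norm x powr (- \<kappa>) * norm x powr \<gamma>"
          unfolding powr_add[symmetric] \<kappa>_def by simp
        ultimately show ?thesis using x
          by (subst ennreal_mult[symmetric]) (auto simp: abs_mult mult.assoc intro!: ennreal_leI)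
      next
        case False
        then show ?thesis by (auto simp: indicator_def)
      qed
    qed
    also have "\<dots> = ennreal (a powr (- \<kappa> / 2)) * ennreal A"
      using A True by (subst nn_integral_cmult[OF gm]) (simp add: N_over_conj_def)
    also have "\<dots> = ennreal (1 * a powr (- \<kappa> / 2) * A powr (1 / p))"
      using A True by (simp add: ennreal_mult)
    finally show "(\<integral>\<^sup>+x. indicator (tail_set up a) x * ennreal (norm x powr (1 - N) * \<bar>g x\<bar>) \<partial>lebesgue) \<le> \<dots>" .
  qed
next
  case False
  with p have p: "1 < p" by simp
  define q where "q = p / (p - 1)"
  have q: "1 < q" "1 / p + 1 / q = 1" using p by (auto simp: q_def field_simps)
  have Nq: "N_over_conj N p = N / q" using p by (simp add: N_over_conj_def q_def field_simps)
  define w where "w = N * unit_ball_vol N"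
  have w: "w > 0" by (simp add: w_def N_def)
  \<comment> \<open>This is the conjugate norm of the leftover power over the tail, namely
    \<open>?B powr (1 / q)\<close> below, with its power of \<open>a\<close> removed.\<close>
  define C where "C = (w / (\<bar>\<kappa>\<bar> * q)) powr (1 / q)"
  \<comment> \<open>The constant is fixed before the sign condition is available. At
    \<open>\<kappa> = 0\<close> the formula for \<open>C\<close> degenerates to 0, so 1 is supplied
    for positivity; for \<open>p > 1\<close> the sign condition excludes that case.\<close>
  show thesis
  proof (rule that[of "if \<kappa> = 0 then 1 else C"])
    show "0 < (if \<kappa> = 0 then 1 else C)" using w q by (simp add: C_def)
    fix up and a A :: real and g :: "'a \<Rightarrow> real"
    assume a: "0 < a" and "(if up then \<kappa> > 0 else \<kappa> < 0) \<or> p = 1 \<and> \<kappa> = 0" and g: "g \<in> borel_measurable lebesgue"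
      and A: "0 \<le> A" "(\<integral>\<^sup>+x. ennreal (\<bar>norm x powr (\<gamma> + N_over_conj N p) * g x\<bar> powr p) \<partial>lebesgue) = ennreal A"
    then have \<kappa>: "if up then \<kappa> > 0 else \<kappa> < 0" and \<kappa>0: "\<kappa> \<noteq> 0" using p by (auto split: if_splits)
    let ?f = "\<lambda>x::'a. \<bar>norm x powr (\<gamma> + N_over_conj N p) * g x\<bar>"
    let ?h = "\<lambda>x::'a. indicator (tail_set up a) x * norm x powr (- \<kappa> - N / q)"
    let ?B = "w / (\<bar>\<kappa>\<bar> * q) * a powr (- \<kappa> * q / 2)"
    have B: "(\<integral>\<^sup>+x. ennreal (?h x powr q) \<partial>lebesgue) = ennreal ?B"
    proof -
      let ?t = "\<lambda>s. ennreal (indicator {s. if up then a \<le> s else s \<le> a} s * s powr (- \<kappa> * q / 2 - 1))"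
      have "ennreal (?h x powr q) = ?t (x \<bullet> x) * ennreal (norm x powr (2 - N))" for x :: 'a
      proof -
        have "(- \<kappa> - N / q) * q = (- \<kappa> * q - 2) + (2 - N)"
          using q by (simp add: left_diff_distrib)
        then have "(norm x powr (- \<kappa> - N / q)) powr q = norm x powr (- \<kappa> * q - 2) * norm x powr (2 - N)"
          by (simp only: powr_powr powr_add[symmetric])
        also have "norm x powr (- \<kappa> * q - 2) = (x \<bullet> x) powr (- \<kappa> * q / 2 - 1)"
          by (simp add: norm_powr_eq_inner_powr diff_divide_distrib)
        finally show ?thesis
          using q by (cases "x \<in> tail_set up a") (auto simp: tail_set_def indicator_def ennreal_mult)
      qed
      then have "(\<integral>\<^sup>+x. ennreal (?h x powr q) \<partial>lebesgue) = (\<integral>\<^sup>+x. ?t ((x::'a) \<bullet> x) * ennreal (norm x powr (2 - N)) \<partial>lborel)"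
        by (simp add: nn_integral_completion)
      also have "\<dots> = ennreal (w / 2) * (\<integral>\<^sup>+s. ?t s * indicator {0<..} s \<partial>lborel)"
        unfolding N_def w_def by (rule nn_integral_inner_self) (cases up; simp)
      also have "(\<integral>\<^sup>+s. ?t s * indicator {0<..} s \<partial>lborel) = ennreal (a powr (- \<kappa> * q / 2) / \<bar>- \<kappa> * q / 2\<bar>)"
        using \<kappa> q a by (intro nn_integral_powr_tail) (auto simp: mult_less_0_iff zero_less_mult_iff)
      also have "ennreal (w / 2) * \<dots> = ennreal ?B"
        using w q by (subst ennreal_mult[symmetric]) (auto simp: abs_mult field_simps)
      finally show ?thesis .
    qed
    have "(\<integral>\<^sup>+x. indicator (tail_set up a) x * ennreal (norm x powr (1 - N) * \<bar>g x\<bar>) \<partial>lebesgue)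
      = (\<integral>\<^sup>+x. ennreal (?f x * ?h x) \<partial>lebesgue)"
    proof (intro nn_integral_cong)
      fix x :: 'a
      have "norm x powr (1 - N) = norm x powr (\<gamma> + N_over_conj N p) * norm x powr (- \<kappa> - N / q)"
        unfolding powr_add[symmetric] \<kappa>_def Nq by simp
      then show "indicator (tail_set up a) x * ennreal (norm x powr (1 - N) * \<bar>g x\<bar>) = ennreal (?f x * ?h x)"
        by (auto simp: indicator_def abs_mult mult_ac)
    qed
    also have "\<dots> \<le> ennreal (A powr (1 / p) * ?B powr (1 / q))"
    proof (rule nn_integral_Holder[OF _ _ _ _ p q A(2,1) B])
      have [measurable]: "(\<lambda>x::'a. norm x powr c) \<in> borel_measurable lebesgue" for c
        by (rule measurable_completion) measurable
      show "?f \<in> borel_measurable lebesgue" using g by measurable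
      show "?h \<in> borel_measurable lebesgue" by (rule measurable_completion) measurable
      show "0 < ?B" using w q \<kappa>0 a by simp
    qed auto
    also have "?B powr (1 / q) = C * a powr (- \<kappa> / 2)"
    proof -
      have "(- \<kappa> * q / 2) * (1 / q) = - \<kappa> / 2" using q by simp
      then have "(a powr (- \<kappa> * q / 2)) powr (1 / q) = a powr (- \<kappa> / 2)"
        by (simp only: powr_powr)
      then show ?thesis using w q by (simp only: C_def powr_mult)
    qed
    finally show "(\<integral>\<^sup>+x. indicator (tail_set up a) x * ennreal (norm x powr (1 - N) * \<bar>g x\<bar>) \<partial>lebesgue)
      \<le> ennreal ((if \<kappa> = 0 then 1 else C) * a powr (- \<kappa> / 2) * A powr (1 / p))"
      using \<kappa>0 by (simp add: mult_ac)
  qed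
qed

theorem theorem3p6:
  fixes \<gamma> p :: real
  assumes "1 \<le> p"
  shows "\<exists>C>0. \<forall>(u::'a::euclidean_space \<Rightarrow> real) g.
    radially_symmetric u \<and> W11_loc u g \<and>
    ((\<gamma> > 1 - real DIM('a) \<and> W11_minus u) \<or>
     (\<gamma> < 1 - real DIM('a) \<and> W11_plus u) \<or>
     (p = 1 \<and> \<gamma> = 1 - real DIM('a) \<and> (W11_minus u \<or> W11_plus u)))
    \<longrightarrow> Linf_norm (\<lambda>x. norm x powr (real DIM('a) - 1 + \<gamma>) * u x)
        \<le> ereal C * Lp_norm p (\<lambda>x. norm x powr (\<gamma> + N_over_conj (real DIM('a)) p) * g x)"
proof -
  define N where "N = real DIM('a)"
  define \<kappa> where "\<kappa> = N - 1 + \<gamma>"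
  define w where "w = N * unit_ball_vol N"
  have w: "w > 0" by (simp add: w_def N_def)
  obtain C where C: "C > 0" and tail: "\<And>up a A (g :: 'a \<Rightarrow> real).
    g \<in> borel_measurable lebesgue \<Longrightarrow> 0 < a \<Longrightarrow> 0 \<le> A \<Longrightarrow>
    (if up then \<kappa> > 0 else \<kappa> < 0) \<or> p = 1 \<and> \<kappa> = 0 \<Longrightarrow>
    (\<integral>\<^sup>+x. ennreal (\<bar>norm x powr (\<gamma> + N_over_conj N p) * g x\<bar> powr p) \<partial>lebesgue) = ennreal A \<Longrightarrow>
    (\<integral>\<^sup>+x. indicator (tail_set up a) x * ennreal (norm x powr (1 - N) * \<bar>g x\<bar>) \<partial>lebesgue)
      \<le> ennreal (C * a powr (- \<kappa> / 2) * A powr (1 / p))"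
    using weighted_tail_bound[OF assms, where 'a = 'a and \<gamma> = \<gamma>] unfolding \<kappa>_def N_def by blast
  have main: "Linf_norm (\<lambda>x. norm x powr \<kappa> * u x)
      \<le> ereal (C / w) * Lp_norm p (\<lambda>x. norm x powr (\<gamma> + N_over_conj N p) * g x)"
    if rad: "radially_symmetric u" and W: "W11_loc u g" and lim: "if up then W11_minus u else W11_plus u"
      and \<kappa>: "(if up then \<kappa> > 0 else \<kappa> < 0) \<or> p = 1 \<and> \<kappa> = 0" for u g :: "'a \<Rightarrow> real" and up
  proof (cases "(\<integral>\<^sup>+x. ennreal (\<bar>norm x powr (\<gamma> + N_over_conj N p) * g x\<bar> powr p) \<partial>lebesgue) = \<infinity>")
    case True
    then show ?thesis using C w by (simp add: Lp_norm_def Let_def)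
  next
    case False
    then obtain A where A: "0 \<le> A" "(\<integral>\<^sup>+x. ennreal (\<bar>norm x powr (\<gamma> + N_over_conj N p) * g x\<bar> powr p) \<partial>lebesgue) = ennreal A"
      by (cases "\<integral>\<^sup>+x. ennreal (\<bar>norm x powr (\<gamma> + N_over_conj N p) * g x\<bar> powr p) \<partial>lebesgue") auto
    define L where "L = C * A powr (1 / p)"
    have um: "u \<in> borel_measurable lebesgue" and gm: "g \<in> borel_measurable lebesgue"
      using W by (auto simp: W11_loc_def intro: L1_loc_punct_measurable)
    obtain V where V: "V \<in> borel_measurable borel"
      and uV: "AE s in lborel. s > 0 \<longrightarrow> (\<forall>x. x \<bullet> x = s \<longrightarrow> u x = V s)"
      using radial_borel_profile[OF rad um] .
    have "AE a in lborel. a > 0 \<longrightarrow> w * \<bar>V a\<bar> \<le> a powr (- \<kappa> / 2) * L"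
      using profile_tail_bound[OF rad W V uV lim]
    proof eventually_elim
      case (elim a)
      show ?case
      proof
        assume a: "a > 0"
        have le: "w * \<bar>V a\<bar> \<le> c powr (- \<kappa> / 2) * L" if c: "if up then c = a else a < c" for c
        proof -
          have "c > 0" using a c by (auto split: if_splits)
          have "ennreal (w * \<bar>V a\<bar>) \<le> ennreal (C * c powr (- \<kappa> / 2) * A powr (1 / p))"
            using elim a c tail[OF gm \<open>c > 0\<close> A(1) \<kappa> A(2)] unfolding w_def N_def by (blast intro: order_trans)
          then show ?thesis using C by (simp add: L_def mult_ac ennreal_le_iff)
        qed
        show "w * \<bar>V a\<bar> \<le> a powr (- \<kappa> / 2) * L"
        proof (cases up)
          case True
          then show ?thesis using le[of a] by simp
        next
          case False
          \<comment> \<open>For the interior tail only thresholds above \<open>a\<close> are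
            available. The right-hand side is continuous in \<open>c\<close>, so letting
            \<open>c\<close> decrease to \<open>a\<close> closes the gap.\<close>
          have "((\<lambda>c. c powr (- \<kappa> / 2) * L) \<longlongrightarrow> a powr (- \<kappa> / 2) * L) (at_right a)"
            using a by (intro tendsto_intros) auto
          moreover have "eventually (\<lambda>c. w * \<bar>V a\<bar> \<le> c powr (- \<kappa> / 2) * L) (at_right a)"
            unfolding eventually_at_filter using False le by (intro always_eventually) auto
          ultimately show ?thesis by (rule tendsto_lowerbound) simp
        qed
      qed
    qed
    with uV have "AE s in lborel. s > 0 \<longrightarrow> (\<forall>x. x \<bullet> x = s \<longrightarrow> u x = V s) \<and> w * \<bar>V s\<bar> \<le> s powr (- \<kappa> / 2) * L"
      by eventually_elim auto
    from AE_inner_self[where 'a = 'a, OF this] have "AE x in lborel. ereal \<bar>norm x powr \<kappa> * u x\<bar> \<le> ereal (C / w * A powr (1 / p))"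
    proof eventually_elim
      case (elim x)
      show ?case
      proof (cases "x = 0")
        case False
        then have "w * \<bar>u x\<bar> \<le> norm x powr (- \<kappa>) * L"
          using elim by (simp add: norm_powr_eq_inner_powr)
        then have "norm x powr \<kappa> * (w * \<bar>u x\<bar>) \<le> norm x powr \<kappa> * (norm x powr (- \<kappa>) * L)"
          by (intro mult_left_mono) auto
        also have "\<dots> = L" using False by (simp add: powr_add[symmetric] flip: mult.assoc)
        finally show ?thesis using w by (simp add: L_def abs_mult field_simps)
      qed (use C w in simp)
    qed
    then have ae: "AE x in lebesgue. ereal \<bar>norm x powr \<kappa> * u x\<bar> \<le> ereal (C / w * A powr (1 / p))"
      by (rule AE_completion)
    have "(\<lambda>x::'a. norm x powr \<kappa>) \<in> borel_measurable lebesgue" by (rule measurable_completion) measurable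
    then have "(\<lambda>x. ereal \<bar>norm x powr \<kappa> * u x\<bar>) \<in> borel_measurable lebesgue"
      using um by measurable
    from esssup_I[OF this ae] show ?thesis
      using A by (simp add: Linf_norm_def Lp_norm_def)
  qed
  show ?thesis
  proof (intro exI[of _ "C / w"] conjI allI impI)
    show "C / w > 0" using C w by simp
    fix u g :: "'a \<Rightarrow> real"
    assume *: "radially_symmetric u \<and> W11_loc u g \<and>
    ((\<gamma> > 1 - real DIM('a) \<and> W11_minus u) \<or>
     (\<gamma> < 1 - real DIM('a) \<and> W11_plus u) \<or>
     (p = 1 \<and> \<gamma> = 1 - real DIM('a) \<and> (W11_minus u \<or> W11_plus u)))"
    \<comment> \<open>For \<kappa> \<noteq> 0 the sign of \<kappa> decides the tail. In the
      borderline case \<open>p = 1\<close>, \<kappa> = 0 either tail works, and the assumed lower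
      limit decides.\<close>
    then obtain up where "if up then W11_minus u else W11_plus u"
      "(if up then \<kappa> > 0 else \<kappa> < 0) \<or> p = 1 \<and> \<kappa> = 0"
      unfolding \<kappa>_def N_def by (smt (verit, best))
    from main[OF _ _ this, of g] * show "Linf_norm (\<lambda>x. norm x powr (real DIM('a) - 1 + \<gamma>) * u x)
        \<le> ereal (C / w) * Lp_norm p (\<lambda>x. norm x powr (\<gamma> + N_over_conj (real DIM('a)) p) * g x)"
      by (simp add: \<kappa>_def N_def)
  qed
qed

end
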